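(* Let $G$ be an $N$-graph with assigned angles given by $\mathcal D$. For every network $\mathcal N=(G,\Gamma)\in\mathcal C_{\mathrm{Deg}}$ there exists a sequence of networks $\{\mathcal N_n\}_{n\in\mathbb N}\subset\mathcal C_{\mathrm{Reg}}$, $\mathcal N_n=(G,\Gamma_n)$, such that $\mathcal N_n\to\mathcal N$ strongly in $H^2$ and $\mathcal E(\mathcal N_n)\to\overline{\mathcal E}(\mathcal N)$.
   Context: Fix integers $N\ge 1$, $d\ge2$. Let $I_i=[0,1]\times\{i\}$ for $i=1,\dots,N$, $E=\bigcup_i I_i$, $V=\bigcup_i\{0,1\}\times\{i\}$. An $N$-graph is a topological quotient $G=E/\sim$, where $\sim$ is an equivalence relation identifying points of $V$ only; $\pi:E\to G$ is the projection, $E_i=\pi(I_i)$ are the edges, $V_G=\pi(V)$ the vertices (junctions). For $p\in V_G$, $\pi^{-1}(p)$ is a finite set of pairs $(z,i)\in\{0,1\}\times\{1,\dots,N\}$. A subgraph $H\subseteq G$ is the union of a (possibly empty) collection of edges with the same identifications. A network is a pair $\mathcal N=(G,\Gamma)$ with $\Gamma:G\to\mathbb R^d$ continuous such that each $\gamma^i=\Gamma|_{E_i}$ (viewed as a map on $[0,1]$) is either constant (a singular curve) or an immersion of class $H^2$ (a regular curve); curves are considered up to reparametrization. $\mathrm{Sing}(\mathcal N)$ is the subgraph whose edges are those carrying singular curves; $\mathcal N$ is regular if $\mathrm{Sing}(\mathcal N)=\emptyset$. A sequence $(G,\Gamma_n)$ converges to $(G,\Gamma_\infty)$ in a given topology if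 for every $i$ the curves $\Gamma_n|_{E_i}$ converge to $\Gamma_\infty|_{E_i}$, up to reparametrization, in that topology. Outer tangents: for a regular curve $\gamma^i$ and $z\in\{0,1\}$, $\tau^{z,i}=(-1)^z\dot\gamma^i(z)/|\dot\gamma^i(z)|$. $G$ has assigned angles if a unit vector $d^{z,i}\in\mathbb S^{d-1}$ is given for each $(z,i)\in\{0,1\}\times\{1,\dots,N\}$; $\mathcal D$ is the collection of these; subgraphs inherit the assignment. Angle condition: a (possibly singular) network $(G,\Gamma)$ satisfies the angle condition if for every singular curve $\gamma^i$ there exist unit vectors $\tau^{0,i}=-\tau^{1,i}$ (virtual tangents) such that for every $p\in V_G$ there is a rotation $\mathrm R_p$ of $\mathbb R^d$ with $\tau^{z,i}=\mathrm R_p(d^{z,i})$ for all $(z,i)\in\pi^{-1}(p)$, where $\tau^{z,i}$ is the real outer tangent if $\gamma^i$ is regular and the virtual one if $\gamma^i$ is singular. $\mathcal C_{\mathrm{Reg}}$ is the class of regular networks $(G,\Gamma)$ satisfying the angle condition. Stratified straight: a subgraph $H\subseteq G$ is stratified straight if there are subgraphs $\emptyset=H_q\subset H_{q-1}\subset\dots\subset H_1\subset H_0=H$ and maps $\Sigma_j:H_j\to\mathbb R^d$ such that for $j=0,\dots,q-1$: $(H_j,\Sigma_j)$ is a network satisfying the angle condition, with (real or virtual) tangents coinciding with those associated with $(H_0,\Sigma_0)$, its regular curves are straight segments, and $H_{j+1}=\mathrm{Sing}((H_j,\Sigma_j))$. Degenerate networks: $\mathcal N=(G,\Gamma)$ belongs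 to $\mathcal C_{\mathrm{Deg}}$ if it satisfies the angle condition with some (real or virtual) tangents $\tau^{z,i}$ and $\mathrm{Sing}(\mathcal N)$ is a stratified straight subgraph with (real or virtual) tangents coinciding with these $\tau^{z,i}$. (So $\mathcal C_{\mathrm{Reg}}\subset\mathcal C_{\mathrm{Deg}}$.) Energies: for any network, $\widetilde{\mathcal E}(\mathcal N)=\sum_i\big(\int_{\gamma^i}|\vec k^i|^2\,ds+\ell(\gamma^i)\big)$, the sum being over regular curves, with $\vec k^i$ the curvature vector, $s$ arclength and $\ell$ length (singular curves contribute $0$). $\mathcal E$ denotes this functional on regular networks. $\overline{\mathcal E}(\mathcal N)=\widetilde{\mathcal E}(\mathcal N)$ if $\mathcal N\in\mathcal C_{\mathrm{Deg}}$ and $\overline{\mathcal E}(\mathcal N)=+\infty$ otherwise. *)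

theory Defs
  imports "HOL-Analysis.Analysis"
begin

section \<open>Graphs\<close>

text \<open>A point \<open>(t, i)\<close> is the point of parameter \<open>t\<close> on the \<open>i\<close>-th copy of the unit interval.
  Subgraphs are given by the set \<open>S\<close> of indices of their edges; the whole graph is \<open>S = {1..N}\<close>.\<close>

type_synonym point = "real \<times> nat"

definition intervals :: "nat set \<Rightarrow> point set" where
  "intervals S = {0..1} \<times> S"

definition endpoints :: "nat set \<Rightarrow> point set" where
  "endpoints S = {0, 1} \<times> S"

definition N_graph :: "nat \<Rightarrow> (point \<times> point) set \<Rightarrow> bool" where
  "N_graph N r \<longleftrightarrow> equiv (intervals {1..N}) r \<and>
     (\<forall>x y. (x, y) \<in> r \<longrightarrow> x = y \<or> x \<in> endpoints {1..N} \<and> y \<in> endpoints {1..N})"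

text \<open>The quotient topology on \<open>intervals {1..N} // r\<close>, see \<open>quotient_map_graph_topology\<close> below.
  \<open>graph_proj r\<close> is the projection onto the quotient.\<close>

abbreviation "graph_proj \<equiv> Equiv_Relations.proj"

definition graph_topology :: "nat \<Rightarrow> (point \<times> point) set \<Rightarrow> point set topology" where
  "graph_topology N r = topology (\<lambda>U. U \<subseteq> intervals {1..N} // r \<and>
     openin (top_of_set (intervals {1..N})) {x \<in> intervals {1..N}. graph_proj r x \<in> U})"

lemma openin_graph_topology:
  "openin (graph_topology N r) U \<longleftrightarrow> U \<subseteq> intervals {1..N} // r \<and>
     openin (top_of_set (intervals {1..N})) {x \<in> intervals {1..N}. graph_proj r x \<in> U}"
proof -
  let ?E = "intervals {1..N}"
  let ?P = "\<lambda>U. U \<subseteq> ?E // r \<and> openin (top_of_set ?E) {x \<in> ?E. graph_proj r x \<in> U}"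
  have "istopology ?P"
    unfolding istopology_def
  proof (intro conjI allI impI)
    fix U W assume U: "?P U" and W: "?P W"
    have eq: "{x \<in> ?E. graph_proj r x \<in> U \<inter> W} = {x \<in> ?E. graph_proj r x \<in> U} \<inter> {x \<in> ?E. graph_proj r x \<in> W}"
      by auto
    show "U \<inter> W \<subseteq> ?E // r" using U by auto
    show "openin (top_of_set ?E) {x \<in> ?E. graph_proj r x \<in> U \<inter> W}"
      unfolding eq by (rule openin_Int) (use U W in auto)
  next
    fix K assume K: "\<forall>U\<in>K. ?P U"
    have eq: "{x \<in> ?E. graph_proj r x \<in> \<Union>K} = (\<Union>U\<in>K. {x \<in> ?E. graph_proj r x \<in> U})"
      by auto
    show "\<Union>K \<subseteq> ?E // r" using K by auto
    show "openin (top_of_set ?E) {x \<in> ?E. graph_proj r x \<in> \<Union>K}"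
      unfolding eq by (rule openin_Union) (use K in auto)
  qed
  then show ?thesis
    by (simp add: graph_topology_def)
qed

lemma topspace_graph_topology: "topspace (graph_topology N r) = intervals {1..N} // r"
proof -
  have "{x \<in> intervals {1..N}. graph_proj r x \<in> intervals {1..N} // r} = intervals {1..N}"
    by (auto simp: Equiv_Relations.proj_preserves)
  then have "openin (graph_topology N r) (intervals {1..N} // r)"
    by (simp add: openin_graph_topology)
  then show ?thesis
    by (metis openin_graph_topology openin_subset openin_topspace subset_antisym)
qed

lemma quotient_map_graph_topology:
  "quotient_map (top_of_set (intervals {1..N})) (graph_topology N r) (graph_proj r)"
  by (auto simp: quotient_map_def topspace_graph_topology openin_graph_topology
      Equiv_Relations.proj_def quotient_def)

definition subgraph :: "(point \<times> point) set \<Rightarrow> nat set \<Rightarrow> point set set" where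
  "subgraph r S = graph_proj r ` intervals S"

definition vertices :: "(point \<times> point) set \<Rightarrow> nat set \<Rightarrow> point set set" where
  "vertices r S = graph_proj r ` endpoints S"


section \<open>Curves of class \<open>H\<^sup>2\<close>\<close>

text \<open>\<open>g\<close> is the weak derivative of \<open>u\<close> on the unit interval and is square integrable. As usual in
  dimension one, \<open>H\<^sup>1\<close> functions are identified with their absolutely continuous representatives.\<close>

definition has_L2_derivative ::
    "(real \<Rightarrow> 'a::euclidean_space) \<Rightarrow> (real \<Rightarrow> 'a) \<Rightarrow> bool" where
  "has_L2_derivative u g \<longleftrightarrow>
     g \<in> borel_measurable (lebesgue_on {0..1}) \<and>
     integrable (lebesgue_on {0..1}) (\<lambda>t. (norm (g t))\<^sup>2) \<and>
     (\<forall>t\<in>{0..1}. u t = u 0 + integral\<^sup>L (lebesgue_on {0..t}) g)"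

definition H1 :: "(real \<Rightarrow> 'a::euclidean_space) \<Rightarrow> bool" where
  "H1 u \<longleftrightarrow> (\<exists>g. has_L2_derivative u g)"

text \<open>Determined up to a null set if \<open>H1 u\<close>.\<close>

definition L2_derivative :: "(real \<Rightarrow> 'a::euclidean_space) \<Rightarrow> real \<Rightarrow> 'a" where
  "L2_derivative u = (SOME g. has_L2_derivative u g)"

definition velocity :: "(real \<Rightarrow> 'a::euclidean_space) \<Rightarrow> real \<Rightarrow> 'a" where
  "velocity c t = vector_derivative c (at t within {0..1})"

definition H2 :: "(real \<Rightarrow> 'a::euclidean_space) \<Rightarrow> bool" where
  "H2 c \<longleftrightarrow> (\<forall>t\<in>{0..1}. c differentiable (at t within {0..1})) \<and> H1 (velocity c)"

definition H2_norm :: "(real \<Rightarrow> 'a::euclidean_space) \<Rightarrow> real" where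
  "H2_norm c = sqrt (integral\<^sup>L (lebesgue_on {0..1}) (\<lambda>t. (norm (c t))\<^sup>2)
     + integral\<^sup>L (lebesgue_on {0..1}) (\<lambda>t. (norm (velocity c t))\<^sup>2)
     + integral\<^sup>L (lebesgue_on {0..1}) (\<lambda>t. (norm (L2_derivative (velocity c) t))\<^sup>2))"

definition H2_tendsto ::
    "(nat \<Rightarrow> real \<Rightarrow> 'a::euclidean_space) \<Rightarrow> (real \<Rightarrow> 'a) \<Rightarrow> bool" where
  "H2_tendsto c c' \<longleftrightarrow> (\<forall>n. H2 (c n)) \<and> H2 c' \<and> (\<lambda>n. H2_norm (\<lambda>t. c n t - c' t)) \<longlonglongrightarrow> 0"

definition singular_curve :: "(real \<Rightarrow> 'a::euclidean_space) \<Rightarrow> bool" where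
  "singular_curve c \<longleftrightarrow> c constant_on {0..1}"

definition regular_curve :: "(real \<Rightarrow> 'a::euclidean_space) \<Rightarrow> bool" where
  "regular_curve c \<longleftrightarrow> H2 c \<and> (\<forall>t\<in>{0..1}. velocity c t \<noteq> 0)"

text \<open>Reparametrizations keep the orientation, since the endpoints of an edge are labelled.\<close>

definition reparametrization :: "(real \<Rightarrow> real) \<Rightarrow> bool" where
  "reparametrization \<phi> \<longleftrightarrow>
     H2 \<phi> \<and> (\<forall>t\<in>{0..1}. velocity \<phi> t > 0) \<and> \<phi> 0 = 0 \<and> \<phi> 1 = 1"

definition reparametrized ::
    "(real \<Rightarrow> 'a::euclidean_space) \<Rightarrow> (real \<Rightarrow> 'a) \<Rightarrow> bool" where
  "reparametrized c c' \<longleftrightarrow> (\<exists>\<phi>. reparametrization \<phi> \<and> (\<forall>t\<in>{0..1}. c' t = c (\<phi> t)))"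

text \<open>The value at \<open>z \<in> {0, 1}\<close> is the velocity multiplied by \<open>(-1)\<^sup>z\<close> and normalized.\<close>

definition outer_tangent :: "(real \<Rightarrow> 'a::euclidean_space) \<Rightarrow> real \<Rightarrow> 'a" where
  "outer_tangent c z = (if z = 0 then sgn (velocity c z) else - sgn (velocity c z))"

definition unit_tangent :: "(real \<Rightarrow> 'a::euclidean_space) \<Rightarrow> real \<Rightarrow> 'a" where
  "unit_tangent c t = sgn (velocity c t)"

text \<open>The derivative of the unit tangent with respect to arclength.\<close>

definition curvature :: "(real \<Rightarrow> 'a::euclidean_space) \<Rightarrow> real \<Rightarrow> 'a" where
  "curvature c t = L2_derivative (unit_tangent c) t /\<^sub>R norm (velocity c t)"

definition arclength_integral ::
    "(real \<Rightarrow> 'a::euclidean_space) \<Rightarrow> (real \<Rightarrow> real) \<Rightarrow> real" where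
  "arclength_integral c f = integral\<^sup>L (lebesgue_on {0..1}) (\<lambda>t. f t * norm (velocity c t))"

definition curve_length :: "(real \<Rightarrow> 'a::euclidean_space) \<Rightarrow> real" where
  "curve_length c = arclength_integral c (\<lambda>t. 1)"

definition straight_segment :: "(real \<Rightarrow> 'a::euclidean_space) \<Rightarrow> bool" where
  "straight_segment c \<longleftrightarrow> path_image c = closed_segment (pathstart c) (pathfinish c)"


section \<open>Networks\<close>

definition edge_curve ::
    "(point \<times> point) set \<Rightarrow> (point set \<Rightarrow> 'a) \<Rightarrow> nat \<Rightarrow> real \<Rightarrow> 'a" where
  "edge_curve r \<Gamma> i t = \<Gamma> (graph_proj r (t, i))"

definition network ::
    "nat \<Rightarrow> (point \<times> point) set \<Rightarrow> nat set \<Rightarrow> (point set \<Rightarrow> 'a::euclidean_space) \<Rightarrow> bool" where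
  "network N r S \<Gamma> \<longleftrightarrow>
     continuous_map (subtopology (graph_topology N r) (subgraph r S)) euclidean \<Gamma> \<and>
     (\<forall>i\<in>S. singular_curve (edge_curve r \<Gamma> i) \<or> regular_curve (edge_curve r \<Gamma> i))"

definition Sing ::
    "(point \<times> point) set \<Rightarrow> nat set \<Rightarrow> (point set \<Rightarrow> 'a::euclidean_space) \<Rightarrow> nat set" where
  "Sing r S \<Gamma> = {i \<in> S. singular_curve (edge_curve r \<Gamma> i)}"

definition assigned_angles :: "nat \<Rightarrow> (point \<Rightarrow> 'a::euclidean_space) \<Rightarrow> bool" where
  "assigned_angles N D \<longleftrightarrow> (\<forall>x\<in>endpoints {1..N}. norm (D x) = 1)"

text \<open>\<open>\<tau>\<close> consists of the real outer tangents of the regular curves of \<open>(S, \<Gamma>)\<close> and of admissible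
  virtual tangents of the singular ones.\<close>

definition tangents ::
    "(point \<times> point) set \<Rightarrow> nat set \<Rightarrow> (point set \<Rightarrow> 'a::euclidean_space) \<Rightarrow> (point \<Rightarrow> 'a) \<Rightarrow> bool"
  where
  "tangents r S \<Gamma> \<tau> \<longleftrightarrow> (\<forall>i\<in>S.
     if singular_curve (edge_curve r \<Gamma> i)
     then norm (\<tau> (0, i)) = 1 \<and> \<tau> (0, i) = - \<tau> (1, i)
     else \<forall>z\<in>{0, 1}. \<tau> (z, i) = outer_tangent (edge_curve r \<Gamma> i) z)"

definition angle_condition ::
    "(point \<times> point) set \<Rightarrow> (point \<Rightarrow> real^'d) \<Rightarrow> nat set \<Rightarrow> (point set \<Rightarrow> real^'d) \<Rightarrow>
     (point \<Rightarrow> real^'d) \<Rightarrow> bool" where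
  "angle_condition r D S \<Gamma> \<tau> \<longleftrightarrow> tangents r S \<Gamma> \<tau> \<and>
     (\<forall>p\<in>vertices r S. \<exists>R. rotation_matrix R \<and>
        (\<forall>x\<in>endpoints S. graph_proj r x = p \<longrightarrow> \<tau> x = R *v D x))"

text \<open>All the levels share one family \<open>\<tau>\<close>: this is the requirement that the tangents
  of each level coincide with those of level 0.\<close>

definition stratified_straight ::
    "nat \<Rightarrow> (point \<times> point) set \<Rightarrow> (point \<Rightarrow> real^'d) \<Rightarrow> nat set \<Rightarrow> (point \<Rightarrow> real^'d) \<Rightarrow> bool" where
  "stratified_straight N r D S \<tau> \<longleftrightarrow>
     (\<exists>(q::nat) (H :: nat \<Rightarrow> nat set) (\<Sigma> :: nat \<Rightarrow> point set \<Rightarrow> real^'d).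
        H 0 = S \<and> H q = {} \<and>
        (\<forall>j<q. H (Suc j) \<subset> H j \<and>
           network N r (H j) (\<Sigma> j) \<and>
           angle_condition r D (H j) (\<Sigma> j) \<tau> \<and>
           (\<forall>i\<in>H j. regular_curve (edge_curve r (\<Sigma> j) i) \<longrightarrow>
              straight_segment (edge_curve r (\<Sigma> j) i)) \<and>
           H (Suc j) = Sing r (H j) (\<Sigma> j)))"

definition C_Reg ::
    "nat \<Rightarrow> (point \<times> point) set \<Rightarrow> (point \<Rightarrow> real^'d) \<Rightarrow> (point set \<Rightarrow> real^'d) set" where
  "C_Reg N r D = {\<Gamma>. network N r {1..N} \<Gamma> \<and> Sing r {1..N} \<Gamma> = {} \<and>
     (\<exists>\<tau>. angle_condition r D {1..N} \<Gamma> \<tau>)}"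

definition C_Deg ::
    "nat \<Rightarrow> (point \<times> point) set \<Rightarrow> (point \<Rightarrow> real^'d) \<Rightarrow> (point set \<Rightarrow> real^'d) set" where
  "C_Deg N r D = {\<Gamma>. network N r {1..N} \<Gamma> \<and>
     (\<exists>\<tau>. angle_condition r D {1..N} \<Gamma> \<tau> \<and>
          stratified_straight N r D (Sing r {1..N} \<Gamma>) \<tau>)}"

definition networks_tendsto_H2 ::
    "nat \<Rightarrow> (point \<times> point) set \<Rightarrow> (nat \<Rightarrow> point set \<Rightarrow> 'a::euclidean_space) \<Rightarrow>
     (point set \<Rightarrow> 'a) \<Rightarrow> bool" where
  "networks_tendsto_H2 N r \<Gamma>n \<Gamma> \<longleftrightarrow> (\<forall>i\<in>{1..N}. \<exists>c c'.
     (\<forall>n. reparametrized (edge_curve r (\<Gamma>n n) i) (c n)) \<and>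
     reparametrized (edge_curve r \<Gamma> i) c' \<and> H2_tendsto c c')"


section \<open>Energies\<close>

definition energy ::
    "nat \<Rightarrow> (point \<times> point) set \<Rightarrow> (point set \<Rightarrow> 'a::euclidean_space) \<Rightarrow> real" where
  "energy N r \<Gamma> = (\<Sum>i\<in>{1..N} - Sing r {1..N} \<Gamma>.
     arclength_integral (edge_curve r \<Gamma> i) (\<lambda>t. (norm (curvature (edge_curve r \<Gamma> i) t))\<^sup>2)
     + curve_length (edge_curve r \<Gamma> i))"

definition extended_energy ::
    "nat \<Rightarrow> (point \<times> point) set \<Rightarrow> (point \<Rightarrow> real^'d) \<Rightarrow> (point set \<Rightarrow> real^'d) \<Rightarrow> ereal" where
  "extended_energy N r D \<Gamma> = (if \<Gamma> \<in> C_Deg N r D then ereal (energy N r \<Gamma>) else \<infinity>)"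

end

theory Submission
  imports Defs
begin

text \<open>The singular edges of a degenerate network are opened again, level by level, along the
  straight segments provided by the stratification. Let \<open>\<Sigma>\<^sub>0, \<dots>, \<Sigma>\<^sub>q\<^sub>-\<^sub>1\<close> be the maps of the
  stratification and let \<open>\<epsilon>\<close> be small. A vertex \<open>p\<close> is moved to
  \<open>\<Gamma> p + (\<Sum>k<q. \<epsilon> ^ 2 ^ k *\<^sub>R \<Sigma>\<^sub>k p)\<close>, and the edges have to follow without rotating their tangents.

  An edge that is regular in the limit is corrected by a cubic with zero velocity at both ends; this keeps
  its outer tangents and tends to zero in \<open>H\<^sup>2\<close> (\<open>recovery_curves_regular\<close>). A singular edge has a
  first level \<open>j\<close> on which it is regular, and there it is a segment with direction \<open>Q \<noteq> 0\<close>
  (\<open>stratified_straight_levels\<close>). Since \<open>\<Gamma>\<close> and all the earlier levels are constant on it, its two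
  ends separate by \<open>e *\<^sub>R Q\<close> with \<open>e = \<epsilon> ^ 2 ^ j\<close>, up to contributions of the later levels, which are of
  order \<open>e\<^sup>2\<close> (\<open>multiscale_remainder\<close>). The edge becomes a segment in direction \<open>Q\<close> of
  length of order \<open>e\<close>, plus a cubic of size \<open>e\<^sup>2\<close> with zero velocity at both ends
  (\<open>recovery_curves_collapsed\<close>). Its tangents are those of the segment, that is, the virtual tangents
  of the limit. So all the tangents of the approximating networks agree with the given ones, and the angle
  condition holds with the same rotations.

  Straightness and the doubling exponents make the energy of the opened edges vanish. Only the cubic
  is curved, so the speed is of order \<open>e\<close> and the acceleration of order \<open>e\<^sup>2\<close>, which makes the
  curvature energy of order \<open>e\<^sup>4 / e\<^sup>3 = e\<close> (\<open>elastic_energy_collapsing\<close>). The more obvious scales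
  \<open>\<epsilon> ^ Suc k\<close> would already leave an energy of order one on the second level.

  On the regular edges, the energy converges by dominated convergence (\<open>elastic_energy_perturbed\<close>). This
  needs the curvature in terms of velocity and acceleration, that is, the chain rule
  \<open>has_L2_derivative_chain\<close> for the weak derivative of the normalized velocity, and the uniqueness of weak
  derivatives up to null sets.\<close>

section \<open>Weak derivatives in one dimension\<close>

abbreviation unit_lebesgue :: "real measure" where
  "unit_lebesgue \<equiv> lebesgue_on {0..1}"

lemma finite_measure_unit_lebesgue: "finite_measure unit_lebesgue"
  by (rule finite_measure_lebesgue_on) simp

lemma integrable_of_square_integrable:
  fixes g :: "real \<Rightarrow> 'a::euclidean_space"
  assumes m: "g \<in> borel_measurable unit_lebesgue" and "integrable unit_lebesgue (\<lambda>t. (norm (g t))\<^sup>2)"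
  shows "integrable unit_lebesgue g"
proof -
  interpret finite_measure unit_lebesgue by (rule finite_measure_unit_lebesgue)
  have "norm (g t) \<le> 1 + (norm (g t))\<^sup>2" for t
    using sum_power2_ge_zero[of "norm (g t) - 1/2" 0] by (simp add: power2_eq_square algebra_simps)
  then show ?thesis
    by (intro Bochner_Integration.integrable_bound[of _ "\<lambda>t. 1 + (norm (g t))\<^sup>2" g]
        Bochner_Integration.integrable_add assms) auto
qed

text \<open>The Bochner integral of a function that is not integrable is \<open>0\<close>, which is below \<open>B\<close> as well.\<close>

lemma LINT_unit_le_AE:
  fixes f :: "real \<Rightarrow> real"
  assumes "AE t in unit_lebesgue. f t \<le> B" "0 \<le> B"
  shows "(LINT t|unit_lebesgue. f t) \<le> B"
proof (cases "integrable unit_lebesgue f")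
  case True
  interpret finite_measure unit_lebesgue by (rule finite_measure_unit_lebesgue)
  have "(LINT t|unit_lebesgue. f t) \<le> (LINT t|unit_lebesgue. B)"
    using assms True by (intro integral_mono_AE) auto
  also have "\<dots> = B"
    by (simp add: measure_restrict_space)
  finally show ?thesis .
qed (use assms(2) in \<open>simp add: not_integrable_integral_eq\<close>)

lemma LINT_unit_le:
  fixes f :: "real \<Rightarrow> real"
  assumes "\<And>t. t \<in> {0..1} \<Longrightarrow> f t \<le> B" "0 \<le> B"
  shows "(LINT t|unit_lebesgue. f t) \<le> B"
  using assms by (intro LINT_unit_le_AE AE_I2) auto

lemma has_L2_derivative_integrable:
  "has_L2_derivative u g \<Longrightarrow> integrable unit_lebesgue g"
  unfolding has_L2_derivative_def by (blast intro: integrable_of_square_integrable)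

lemma LINT_eq_integral_initial:
  fixes g :: "real \<Rightarrow> 'a::euclidean_space"
  assumes "integrable unit_lebesgue g" "t \<in> {0..1}"
  shows "integral\<^sup>L (lebesgue_on {0..t}) g = integral {0..t} g"
  using assms
  by (intro lebesgue_integral_eq_integral Equivalence_Lebesgue_Henstock_Integration.integrable_subinterval[OF assms(1)]) auto

text \<open>The gauge integral is better suited to splitting an interval than the Bochner integral. Both agree
  here because square integrable functions on a bounded interval are integrable.\<close>

lemma has_L2_derivative_iff_integral:
  fixes u :: "real \<Rightarrow> 'a::euclidean_space"
  shows "has_L2_derivative u g \<longleftrightarrow> g \<in> borel_measurable unit_lebesgue \<and>
     integrable unit_lebesgue (\<lambda>t. (norm (g t))\<^sup>2) \<and>
     (\<forall>t\<in>{0..1}. u t = u 0 + integral {0..t} g)"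
  unfolding has_L2_derivative_def
  by (intro conj_cong refl ball_cong arg_cong2[where f="(=)"] arg_cong2[where f="(+)"] LINT_eq_integral_initial)
    (auto intro: integrable_of_square_integrable)

lemma has_L2_derivative_continuous_on:
  assumes "has_L2_derivative u g" shows "continuous_on {0..1} u"
proof -
  have "continuous_on {0..1} (\<lambda>t. u 0 + integral {0..t} g)"
    using has_L2_derivative_integrable[OF assms]
    by (intro continuous_intros indefinite_integral_continuous_1 integrable_on_lebesgue_on) auto
  then show ?thesis
    by (rule continuous_on_eq) (use assms in \<open>metis has_L2_derivative_iff_integral\<close>)
qed

lemma has_L2_derivative_increment:
  fixes u :: "real \<Rightarrow> 'a::euclidean_space"
  assumes "has_L2_derivative u g" "0 \<le> a" "a \<le> b" "b \<le> 1"
  shows "u b - u a = integral {a..b} g"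
proof -
  have "g integrable_on {0..1}"
    using has_L2_derivative_integrable[OF assms(1)] by (intro integrable_on_lebesgue_on) auto
  then have "g integrable_on {0..b}"
    by (rule integrable_subinterval_real) (use assms in auto)
  then have "integral {0..a} g + integral {a..b} g = integral {0..b} g"
    using assms by (intro Henstock_Kurzweil_Integration.integral_combine) auto
  moreover have "u a = u 0 + integral {0..a} g" "u b = u 0 + integral {0..b} g"
    using assms(1) order_trans[OF assms(3,4)] order_trans[OF assms(2,3)] assms(2-4)
    unfolding has_L2_derivative_iff_integral by (blast intro: atLeastAtMost_iff[THEN iffD2])+
  ultimately show ?thesis by (metis add_diff_add add_diff_cancel_left add_diff_cancel_left')
qed

lemma has_L2_derivative_C1:
  fixes u :: "real \<Rightarrow> 'a::euclidean_space"
  assumes u: "\<And>t. t \<in> {0..1} \<Longrightarrow> (u has_vector_derivative g t) (at t within {0..1})"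
    and g: "continuous_on {0..1} g"
  shows "has_L2_derivative u g"
  unfolding has_L2_derivative_iff_integral
proof (intro conjI ballI)
  show "g \<in> borel_measurable unit_lebesgue"
    using g by (intro continuous_imp_measurable_on_sets_lebesgue) auto
  show "integrable unit_lebesgue (\<lambda>t. (norm (g t))\<^sup>2)"
    by (intro continuous_imp_integrable_real continuous_intros g)
  fix t :: real assume t: "t \<in> {0..1}"
  have "(g has_integral u t - u 0) {0..t}"
    using t by (intro fundamental_theorem_of_calculus has_vector_derivative_within_subset[OF u]) auto
  then show "u t = u 0 + integral {0..t} g"
    by (simp add: integral_unique)
qed

lemma has_L2_derivative_add:
  fixes u w :: "real \<Rightarrow> 'a::euclidean_space"
  assumes "has_L2_derivative u g" "has_L2_derivative w h"
  shows "has_L2_derivative (\<lambda>t. u t + w t) (\<lambda>t. g t + h t)"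
  unfolding has_L2_derivative_iff_integral
proof (intro conjI ballI)
  have [measurable]: "g \<in> borel_measurable unit_lebesgue" "h \<in> borel_measurable unit_lebesgue"
    using assms unfolding has_L2_derivative_def by auto
  show "(\<lambda>t. g t + h t) \<in> borel_measurable unit_lebesgue" by simp
  show "integrable unit_lebesgue (\<lambda>t. (norm (g t + h t))\<^sup>2)"
  proof (rule Bochner_Integration.integrable_bound)
    show "integrable unit_lebesgue (\<lambda>t. 2 * (norm (g t))\<^sup>2 + 2 * (norm (h t))\<^sup>2)"
      using assms unfolding has_L2_derivative_def by auto
    have "(norm (x + y))\<^sup>2 \<le> 2 * (norm x)\<^sup>2 + 2 * (norm y)\<^sup>2" for x y :: 'a
      using inner_ge_zero[of "x - y"]
      unfolding power2_norm_eq_inner inner_add_left inner_add_right inner_diff_left inner_diff_right inner_commute[of y x]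
      by linarith
    then show "AE t in unit_lebesgue. norm ((norm (g t + h t))\<^sup>2) \<le> norm (2 * (norm (g t))\<^sup>2 + 2 * (norm (h t))\<^sup>2)"
      by auto
  qed simp
  fix t :: real assume t: "t \<in> {0..1}"
  have "g integrable_on {0..1}" "h integrable_on {0..1}"
    using has_L2_derivative_integrable[OF assms(1)] has_L2_derivative_integrable[OF assms(2)]
    by (auto intro!: integrable_on_lebesgue_on)
  then have "g integrable_on {0..t}" "h integrable_on {0..t}"
    using t by (auto intro: integrable_subinterval_real)
  then have "integral {0..t} (\<lambda>t. g t + h t) = (u t - u 0) + (w t - w 0)"
    using t has_L2_derivative_increment[OF assms(1), of 0 t] has_L2_derivative_increment[OF assms(2), of 0 t]
    by (simp add: Henstock_Kurzweil_Integration.integral_add)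
  then show "u t + w t = u 0 + w 0 + integral {0..t} (\<lambda>t. g t + h t)"
    by simp
qed

lemma has_L2_derivative_cong:
  assumes "\<And>t. t \<in> {0..1} \<Longrightarrow> u t = u' t" "\<And>t. t \<in> {0..1} \<Longrightarrow> g t = g' t"
  shows "has_L2_derivative u g \<longleftrightarrow> has_L2_derivative u' g'"
proof -
  have "integral\<^sup>L (lebesgue_on {0..t}) g = integral\<^sup>L (lebesgue_on {0..t}) g'" if "t \<in> {0..1}" for t
    using that assms by (intro Bochner_Integration.integral_cong) auto
  moreover have "g \<in> borel_measurable unit_lebesgue \<longleftrightarrow> g' \<in> borel_measurable unit_lebesgue"
    using assms by (intro measurable_cong) auto
  moreover have "integrable unit_lebesgue (\<lambda>t. (norm (g t))\<^sup>2) \<longleftrightarrow> integrable unit_lebesgue (\<lambda>t. (norm (g' t))\<^sup>2)"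
    using assms by (intro Bochner_Integration.integrable_cong) auto
  moreover have "u 0 = u' 0" using assms(1)[of 0] by simp
  ultimately show ?thesis
    unfolding has_L2_derivative_def using assms(1) by (intro conj_cong ball_cong refl) auto
qed

text \<open>Lebesgue's differentiation theorem, in the form of \<open>integrable_ccontinuous_explicit\<close>: outside
  a null set, the value of the difference \<open>g - g'\<close> is the limit of its averages over small
  intervals, and these averages vanish since \<open>g\<close> and \<open>g'\<close> have the same integrals.\<close>

lemma has_L2_derivative_unique:
  fixes u :: "real \<Rightarrow> 'a::euclidean_space"
  assumes "has_L2_derivative u g" "has_L2_derivative u g'"
  shows "AE t in unit_lebesgue. g t = g' t"
proof -
  define f where "f t = (if t \<in> {0..1} then g t - g' t else 0)" for t
  have gi: "g integrable_on {0..1}" "g' integrable_on {0..1}"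
    using has_L2_derivative_integrable[OF assms(1)] has_L2_derivative_integrable[OF assms(2)]
    by (auto intro!: integrable_on_lebesgue_on)
  have "(\<lambda>t. g t - g' t) integrable_on {0..1}"
    using gi by (rule integrable_diff)
  then have "f integrable_on UNIV"
    unfolding f_def by (subst integrable_restrict_UNIV)
  then have int: "f integrable_on cbox a b" for a b
    by (rule integrable_on_subcbox) auto
  have zero: "integral {a..b} f = 0" if "0 \<le> a" "a \<le> b" "b \<le> 1" for a b
  proof -
    have "integral {a..b} f = integral {a..b} (\<lambda>t. g t - g' t)"
      using that by (intro integral_cong) (auto simp: f_def)
    also have "\<dots> = integral {a..b} g - integral {a..b} g'"
      using that by (intro Henstock_Kurzweil_Integration.integral_diff integrable_subinterval_real[OF gi(1)] integrable_subinterval_real[OF gi(2)]) auto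
    also have "\<dots> = 0"
      using has_L2_derivative_increment[OF assms(1) that] has_L2_derivative_increment[OF assms(2) that] by simp
    finally show ?thesis .
  qed
  obtain N where N: "negligible N" "\<And>x e. \<lbrakk>x \<notin> N; 0 < e\<rbrakk> \<Longrightarrow>
      \<exists>d>0. \<forall>h. 0 < h \<and> h < d \<longrightarrow> norm (integral (cbox x (x + h *\<^sub>R One)) f /\<^sub>R h ^ DIM(real) - f x) < e"
    using integrable_ccontinuous_explicit[of f] int by metis
  (* Averages are taken over intervals to the right of t, hence t = 1 is left out. *)
  have "g t = g' t" if t: "t \<in> {0..1}" "t \<notin> insert 1 N" for t
  proof (rule ccontr)
    assume "g t \<noteq> g' t"
    then have "norm (f t) > 0" using t by (simp add: f_def)
    then obtain d where d: "d > 0" "\<And>h. 0 < h \<Longrightarrow> h < d \<Longrightarrow> norm (integral {t..t + h} f /\<^sub>R h - f t) < norm (f t)"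
      using N(2)[of t "norm (f t)"] t by auto
    define h where "h = min (d/2) (1 - t)"
    have "h > 0" "h < d" "t + h \<le> 1" using d t by (auto simp: h_def min_def)
    then show False using d(2)[of h] zero[of t "t + h"] t by simp
  qed
  moreover have "negligible (insert 1 N)" using N by simp
  then have "AE t in lebesgue. t \<notin> insert 1 N"
    unfolding negligible_iff_null_sets by (rule AE_not_in)
  then have "AE t in unit_lebesgue. t \<notin> insert 1 N"
    by (subst AE_restrict_space_iff) auto
  ultimately show ?thesis
    by (auto elim: lebesgue_on_mono)
qed

text \<open>\<open>L2_derivative\<close> is a choice among all weak derivatives, so that formulas for curvature and for the
  \<open>H\<^sup>2\<close> norm can only be evaluated almost everywhere.\<close>

lemma L2_derivative_AE_eq:
  fixes u :: "real \<Rightarrow> 'a::euclidean_space"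
  assumes "has_L2_derivative u g"
  shows "AE t in unit_lebesgue. L2_derivative u t = g t"
    and "has_L2_derivative u (L2_derivative u)"
proof -
  show *: "has_L2_derivative u (L2_derivative u)"
    unfolding L2_derivative_def by (rule someI[of "has_L2_derivative u", OF assms])
  show "AE t in unit_lebesgue. L2_derivative u t = g t"
    by (rule has_L2_derivative_unique[OF * assms])
qed

text \<open>The chain rule for absolutely continuous curves. With \<open>h = f' (u) g\<close>, the quantity
  \<open>f (u b) - f (u a) - \<integral>\<^sub>a\<^sup>b h\<close> is additive in the interval, and close to any given parameter it is at most
  \<open>\<eta> \<integral>\<^sub>a\<^sup>b |g|\<close>, because \<open>f\<close> is differentiable, \<open>f' \<circ> u\<close> is continuous and the increments of \<open>u\<close>
  are at most \<open>\<integral> |g|\<close>. A bisection argument propagates this bound to the whole interval, and \<open>\<eta>\<close>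
  is arbitrary.\<close>

lemma has_L2_derivative_chain:
  fixes u :: "real \<Rightarrow> 'a::euclidean_space" and f :: "'a \<Rightarrow> 'b::euclidean_space"
    and f' :: "'a \<Rightarrow> 'a \<Rightarrow>\<^sub>L 'b"
  assumes u: "has_L2_derivative u g"
    and U: "\<And>t. t \<in> {0..1} \<Longrightarrow> u t \<in> U"
    and f: "\<And>x. x \<in> U \<Longrightarrow> (f has_derivative blinfun_apply (f' x)) (at x)"
    and f': "continuous_on U f'"
  shows "has_L2_derivative (\<lambda>t. f (u t)) (\<lambda>t. f' (u t) (g t))"
proof -
  define h where "h = (\<lambda>t. f' (u t) (g t))"
  have cu: "continuous_on {0..1} u" by (rule has_L2_derivative_continuous_on[OF u])
  have cf': "continuous_on {0..1} (\<lambda>t. f' (u t))"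
    by (rule continuous_on_compose2[OF f' cu]) (use U in auto)
  have gm: "g \<in> borel_measurable unit_lebesgue" and g2: "integrable unit_lebesgue (\<lambda>t. (norm (g t))\<^sup>2)"
    using u by (auto simp: has_L2_derivative_def)
  obtain C where C: "\<And>t. t \<in> {0..1} \<Longrightarrow> norm (f' (u t)) \<le> C" "C \<ge> 0"
  proof -
    have "bounded ((\<lambda>t. f' (u t)) ` {0..1})"
      using cf' by (intro compact_imp_bounded compact_continuous_image) auto
    then obtain B where "\<forall>y\<in>(\<lambda>t. f' (u t)) ` {0..1}. norm y \<le> B" unfolding bounded_iff by blast
    then show ?thesis by (intro that[of "max B 0"]) (auto simp: le_max_iff_disj)
  qed
  have hm: "h \<in> borel_measurable unit_lebesgue"
  proof -
    have "(\<lambda>t. \<Sum>i\<in>Basis. (g t \<bullet> i) *\<^sub>R f' (u t) i) \<in> borel_measurable unit_lebesgue"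
    proof (intro borel_measurable_sum borel_measurable_scaleR borel_measurable_inner gm measurable_const)
      show "(\<lambda>t. f' (u t) i) \<in> borel_measurable unit_lebesgue" for i
        by (intro continuous_imp_measurable_on_sets_lebesgue continuous_intros cf') auto
    qed simp
    moreover have "h t = (\<Sum>i\<in>Basis. (g t \<bullet> i) *\<^sub>R f' (u t) i)" for t
      unfolding h_def by (subst (1) euclidean_representation[symmetric, of "g t"])
        (simp only: blinfun.sum_right blinfun.scaleR_right)
    ultimately show ?thesis by (simp cong: measurable_cong)
  qed
  have hle: "norm (h t) \<le> C * norm (g t)" if "t \<in> {0..1}" for t
    unfolding h_def using norm_blinfun[of "f' (u t)" "g t"] C(1)[OF that]
    by (meson mult_right_mono norm_ge_zero order_trans)
  have h2: "integrable unit_lebesgue (\<lambda>t. (norm (h t))\<^sup>2)"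
  proof (rule Bochner_Integration.integrable_bound[of _ "\<lambda>t. C\<^sup>2 * (norm (g t))\<^sup>2"])
    show "AE t in unit_lebesgue. norm ((norm (h t))\<^sup>2) \<le> norm (C\<^sup>2 * (norm (g t))\<^sup>2)"
      using power_mono[OF hle, of _ 2] C(2) by (auto simp: power_mult_distrib intro!: AE_I2)
  qed (use g2 hm in auto)
  have gi: "g integrable_on {0..1}" and ngi: "(\<lambda>t. norm (g t)) integrable_on {0..1}"
    using has_L2_derivative_integrable[OF u] by (auto intro!: integrable_on_lebesgue_on)
  have hi: "h integrable_on {0..1}"
    using integrable_of_square_integrable[OF hm h2] by (auto intro!: integrable_on_lebesgue_on)
  have sub: "g integrable_on {a..b}" "(\<lambda>t. norm (g t)) integrable_on {a..b}" "h integrable_on {a..b}"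
    if "0 \<le> a" "b \<le> 1" for a b
    using that by (auto intro: integrable_subinterval_real[OF gi] integrable_subinterval_real[OF ngi] integrable_subinterval_real[OF hi])
  have nu: "norm (u b - u a) \<le> integral {a..b} (\<lambda>t. norm (g t))" if "0 \<le> a" "a \<le> b" "b \<le> 1" for a b
    unfolding has_L2_derivative_increment[OF u that]
    using that by (intro Henstock_Kurzweil_Integration.integral_norm_bound_integral sub) auto
  (* The total variation bound, the additive gauge against which the defect is measured. *)
  define G where "G a b = integral {a..b} (\<lambda>t. norm (g t))" for a b
  have G_comb: "G a b + G b c = G a c" if "0 \<le> a" "a \<le> b" "b \<le> c" "c \<le> 1" for a b c
    unfolding G_def using that by (intro Henstock_Kurzweil_Integration.integral_combine sub) auto
  have main: "norm (f (u b) - f (u a) - integral {a..b} h) \<le> \<eta> * G a b"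
    if "\<eta> > 0" "0 \<le> a" "a \<le> b" "b \<le> 1" for a b \<eta>
  proof -
    let ?P = "\<lambda>a b. 0 \<le> a \<longrightarrow> b \<le> 1 \<longrightarrow> norm (f (u b) - f (u a) - integral {a..b} h) \<le> \<eta> * G a b"
    have "?P a b"
    proof (rule Bolzano[of a b ?P])
      show "a \<le> b" by fact
    next
      fix x y z assume A: "?P x y" "?P y z" "x \<le> y" "y \<le> z"
      show "?P x z"
      proof (intro impI)
        assume B: "0 \<le> x" "z \<le> 1"
        have "integral {x..y} h + integral {y..z} h = integral {x..z} h"
          using A B by (intro Henstock_Kurzweil_Integration.integral_combine sub) auto
        then have "f (u z) - f (u x) - integral {x..z} h =
            (f (u y) - f (u x) - integral {x..y} h) + (f (u z) - f (u y) - integral {y..z} h)"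
          by (simp add: algebra_simps)
        also have "norm \<dots> \<le> \<eta> * G x y + \<eta> * G y z"
          using A B by (intro norm_triangle_mono) auto
        also have "\<dots> = \<eta> * G x z"
          using G_comb[of x y z] A B by (metis distrib_left)
        finally show "norm (f (u z) - f (u x) - integral {x..z} h) \<le> \<eta> * G x z" .
      qed
    next
      fix x assume x: "a \<le> x" "x \<le> b"
      then have x01: "x \<in> {0..1}" using that by auto
      define L where "L = f' (u x)"
      obtain d1 where d1: "d1 > 0" "\<And>y. norm (y - u x) < d1 \<Longrightarrow>
          norm (f y - f (u x) - L (y - u x)) \<le> \<eta>/2 * norm (y - u x)"
        using f[OF U[OF x01]] \<open>\<eta> > 0\<close> unfolding has_derivative_at_alt L_def by (meson half_gt_zero)
      obtain d2 where d2: "d2 > 0" "\<And>s. s \<in> {0..1} \<Longrightarrow> dist s x < d2 \<Longrightarrow> dist (u s) (u x) < d1"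
        using cu x01 d1(1) unfolding continuous_on_iff by meson
      obtain d3 where d3: "d3 > 0" "\<And>s. s \<in> {0..1} \<Longrightarrow> dist s x < d3 \<Longrightarrow> dist (f' (u s)) L < \<eta>/2"
        using cf' x01 \<open>\<eta> > 0\<close> unfolding continuous_on_iff L_def by (meson half_gt_zero)
      show "\<exists>d>0. \<forall>a b. a \<le> x \<and> x \<le> b \<and> b - a < d \<longrightarrow> ?P a b"
      proof (intro exI[of _ "min d2 d3"] conjI allI impI)
        show "min d2 d3 > 0" using d2 d3 by simp
        fix a b assume ab: "a \<le> x \<and> x \<le> b \<and> b - a < min d2 d3" and a: "0 \<le> a" and b: "b \<le> 1"
        (* The first order expansion is centred at x, which lies between a and b. *)
        have near: "norm (f (u s) - f (u x) - L (u s - u x)) \<le> \<eta>/2 * norm (u s - u x)" if "s \<in> {a..b}" for s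
          using d1(2)[of "u s"] d2(2)[of s] that ab a b by (auto simp: dist_norm)
        have e1: "norm (f (u b) - f (u x) - L (u b - u x)) \<le> \<eta>/2 * G x b"
          using near[of b] nu[of x b] ab a b \<open>\<eta> > 0\<close> unfolding G_def
          by (smt (verit, best) atLeastAtMost_iff mult_left_mono half_gt_zero)
        have e2: "norm (f (u a) - f (u x) - L (u a - u x)) \<le> \<eta>/2 * G a x"
          using near[of a] nu[of a x] ab a b \<open>\<eta> > 0\<close> unfolding G_def norm_minus_commute[of "u a" "u x"]
          by (smt (verit, best) atLeastAtMost_iff mult_left_mono half_gt_zero)
        have Lg: "(\<lambda>s. L (g s)) integrable_on {a..b}" "integral {a..b} (\<lambda>s. L (g s)) = L (integral {a..b} g)"
          using integrable_linear[OF sub(1)[of a b] blinfun.bounded_linear_right, of L]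
            integral_linear[OF sub(1)[of a b] blinfun.bounded_linear_right, of L] a b by (auto simp: o_def)
        have "norm (integral {a..b} (\<lambda>s. h s - L (g s))) \<le> integral {a..b} (\<lambda>s. \<eta>/2 * norm (g s))"
        proof (intro Henstock_Kurzweil_Integration.integral_norm_bound_integral integrable_diff Lg sub a b integrable_on_mult_right)
          fix s assume s: "s \<in> {a..b}"
          have sd: "dist s x < d3" using s ab by (auto simp: dist_real_def abs_if)
          have "h s - L (g s) = (f' (u s) - L) (g s)"
            by (simp add: h_def blinfun.diff_left)
          also have "norm \<dots> \<le> norm (f' (u s) - L) * norm (g s)" by (rule norm_blinfun)
          also have "\<dots> \<le> \<eta>/2 * norm (g s)"
            using d3(2)[of s] sd s a b by (intro mult_right_mono) (auto simp: dist_norm)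
          finally show "norm (h s - L (g s)) \<le> \<eta>/2 * norm (g s)" .
        qed
        then have e3: "norm (integral {a..b} h - L (integral {a..b} g)) \<le> \<eta>/2 * G a b"
          using sub(3)[OF a b] Lg unfolding G_def by (simp add: Henstock_Kurzweil_Integration.integral_diff)
        have inc: "integral {a..b} g = u b - u a"
          using has_L2_derivative_increment[OF u, of a b] ab a b by simp
        have "f (u b) - f (u a) - integral {a..b} h =
           (f (u b) - f (u x) - L (u b - u x)) - (f (u a) - f (u x) - L (u a - u x))
           - (integral {a..b} h - L (integral {a..b} g))"
          unfolding inc by (simp add: blinfun.diff_right)
        also have "norm \<dots> \<le> \<eta>/2 * G x b + \<eta>/2 * G a x + \<eta>/2 * G a b"
          by (intro norm_triangle_le_diff order_trans[OF norm_triangle_ineq4] add_mono e1 e2 e3)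
        also have "\<dots> = \<eta>/2 * (G a x + G x b) + \<eta>/2 * G a b"
          by (simp add: field_simps)
        also have "\<dots> = \<eta> * G a b"
          using G_comb[of a x b] ab a b by simp
        finally show "norm (f (u b) - f (u a) - integral {a..b} h) \<le> \<eta> * G a b" .
      qed
    qed
    with that show ?thesis by simp
  qed
  have "f (u t) = f (u 0) + integral {0..t} h" if t: "t \<in> {0..1}" for t
  proof -
    have "norm (f (u t) - f (u 0) - integral {0..t} h) \<le> \<epsilon>" if "\<epsilon> > 0" for \<epsilon>
    proof -
      have G0: "G 0 t \<ge> 0"
        unfolding G_def using t sub(2)[of 0 t] by (intro Henstock_Kurzweil_Integration.integral_nonneg) auto
      have "norm (f (u t) - f (u 0) - integral {0..t} h) \<le> \<epsilon> / (G 0 t + 1) * G 0 t"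
        using that t G0 by (intro main) auto
      also have "\<dots> \<le> \<epsilon>" using that G0 by (simp add: field_simps)
      finally show ?thesis .
    qed
    then have "norm (f (u t) - f (u 0) - integral {0..t} h) \<le> 0" by (rule field_le_epsilon) simp
    then show ?thesis by (simp add: algebra_simps)
  qed
  with hm h2 show ?thesis
    unfolding has_L2_derivative_iff_integral h_def by blast
qed

section \<open>Velocity and unit tangent\<close>

text \<open>The derivative of \<open>sgn\<close> at \<open>x\<close>: the component of \<open>v\<close> orthogonal to \<open>x\<close>, divided by the length
  of \<open>x\<close>.\<close>

definition sgn_derivative :: "'a::euclidean_space \<Rightarrow> 'a \<Rightarrow> 'a" where
  "sgn_derivative x v = (v - (sgn x \<bullet> v) *\<^sub>R sgn x) /\<^sub>R norm x"

lemma has_derivative_sgn: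
  fixes x :: "'a::euclidean_space"
  assumes "x \<noteq> 0"
  shows "(sgn has_derivative sgn_derivative x) (at x)"
proof -
  have "((\<lambda>y. inverse (norm y)) has_derivative (\<lambda>v. - (inverse (norm x) * (v \<bullet> sgn x) * inverse (norm x)))) (at x)"
    using assms by (intro Deriv.has_derivative_inverse has_derivative_norm) auto
  from has_derivative_scaleR[OF this has_derivative_ident]
  have "((\<lambda>y. y /\<^sub>R norm y) has_derivative
      (\<lambda>v. inverse (norm x) *\<^sub>R v + - (inverse (norm x) * (v \<bullet> sgn x) * inverse (norm x)) *\<^sub>R x)) (at x)" .
  also have "(\<lambda>v. inverse (norm x) *\<^sub>R v + - (inverse (norm x) * (v \<bullet> sgn x) * inverse (norm x)) *\<^sub>R x) = sgn_derivative x"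
    by (simp add: sgn_derivative_def fun_eq_iff sgn_div_norm inner_commute scaleR_diff_right mult_ac)
  finally show ?thesis
    by (simp add: sgn_div_norm[abs_def])
qed

lemma bounded_linear_sgn_derivative: "bounded_linear (sgn_derivative x)"
  unfolding sgn_derivative_def
  by (intro bounded_linear_scaleR_right[THEN bounded_linear_compose] bounded_linear_sub bounded_linear_ident
      bounded_linear_scaleR_left[THEN bounded_linear_compose] bounded_linear_inner_right)

text \<open>An orthogonal projection does not increase norms.\<close>

lemma norm_sgn_derivative_le: "norm (sgn_derivative x v) \<le> norm v / norm x"
proof (cases "x = 0")
  case False
  have "(norm (v - (sgn x \<bullet> v) *\<^sub>R sgn x))\<^sup>2 = (norm v)\<^sup>2 - (sgn x \<bullet> v)\<^sup>2"
  proof -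
    have "sgn x \<bullet> sgn x = 1"
      using False by (simp add: dot_square_norm norm_sgn)
    then show ?thesis
      unfolding power2_norm_eq_inner
      by (simp add: inner_diff_left inner_diff_right inner_commute[of v "sgn x"] power2_eq_square)
  qed
  then have "(norm (v - (sgn x \<bullet> v) *\<^sub>R sgn x))\<^sup>2 \<le> (norm v)\<^sup>2"
    by (metis diff_le_eq le_add_same_cancel1 zero_le_power2)
  then have "norm (v - (sgn x \<bullet> v) *\<^sub>R sgn x) \<le> norm v"
    by (rule power2_le_imp_le) (rule norm_ge_zero)
  then show ?thesis
    unfolding sgn_derivative_def norm_scaleR by (simp add: divide_inverse_commute mult_left_mono)
qed (simp add: sgn_derivative_def)

lemma continuous_on_sgn_derivative: "continuous_on (- {0}) (\<lambda>x. sgn_derivative x v)"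
  unfolding sgn_derivative_def sgn_div_norm by (intro continuous_intros) auto

text \<open>Applied to a velocity, this identifies the weak derivative of the unit tangent.\<close>

lemma has_L2_derivative_sgn:
  fixes u :: "real \<Rightarrow> 'a::euclidean_space"
  assumes "has_L2_derivative u g" "\<And>t. t \<in> {0..1} \<Longrightarrow> u t \<noteq> 0"
  shows "has_L2_derivative (\<lambda>t. sgn (u t)) (\<lambda>t. sgn_derivative (u t) (g t))"
proof -
  define f' where "f' x = Blinfun (sgn_derivative x)" for x :: 'a
  have app: "blinfun_apply (f' x) = sgn_derivative x" for x
    unfolding f'_def by (rule bounded_linear_Blinfun_apply[OF bounded_linear_sgn_derivative])
  have "has_L2_derivative (\<lambda>t. sgn (u t)) (\<lambda>t. f' (u t) (g t))"
  proof (rule has_L2_derivative_chain[OF assms(1), where U = "- {0}"])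
    show "continuous_on (- {0}) f'"
      by (rule continuous_on_blinfun_componentwise) (simp add: app continuous_on_sgn_derivative)
  qed (use assms(2) has_derivative_sgn in \<open>auto simp: app\<close>)
  then show ?thesis by (simp add: app)
qed

lemma velocity_eqI:
  "(c has_vector_derivative v) (at t within {0..1}) \<Longrightarrow> t \<in> {0..1} \<Longrightarrow> velocity c t = v"
  unfolding velocity_def by (intro vector_derivative_within_closed_interval) auto

lemma velocity_cong:
  assumes "\<And>t. t \<in> {0..1} \<Longrightarrow> c t = c' t" "t \<in> {0..1}"
  shows "velocity c t = velocity c' t"
proof -
  have "(c has_vector_derivative v) (at t within {0..1}) \<longleftrightarrow> (c' has_vector_derivative v) (at t within {0..1})" for v
    using assms by (metis has_vector_derivative_transform)
  then show ?thesis
    unfolding velocity_def vector_derivative_def by simp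
qed

lemma H2_has_vector_derivative:
  "H2 c \<Longrightarrow> t \<in> {0..1} \<Longrightarrow> (c has_vector_derivative velocity c t) (at t within {0..1})"
  unfolding H2_def velocity_def by (simp flip: vector_derivative_works)

lemma H2_continuous_on: "H2 c \<Longrightarrow> continuous_on {0..1} c"
  by (metis H2_has_vector_derivative has_vector_derivative_continuous continuous_on_eq_continuous_within)

lemma H2I:
  assumes "\<And>t. t \<in> {0..1} \<Longrightarrow> (c has_vector_derivative v t) (at t within {0..1})"
    and "has_L2_derivative v g"
  shows "H2 c" and "has_L2_derivative (velocity c) g"
proof -
  have "velocity c t = v t" if "t \<in> {0..1}" for t
    using assms(1)[OF that] that by (rule velocity_eqI)
  then show *: "has_L2_derivative (velocity c) g"
    using assms(2) by (subst has_L2_derivative_cong[of _ v]) auto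
  then show "H2 c"
    unfolding H2_def H1_def using assms(1) differentiableI_vector by blast
qed

lemma H2_cong:
  assumes "\<And>t. t \<in> {0..1} \<Longrightarrow> c t = c' t" "H2 c"
  shows "H2 c'"
proof -
  obtain g where "has_L2_derivative (velocity c) g" using assms(2) unfolding H2_def H1_def by blast
  moreover have "(c' has_vector_derivative velocity c t) (at t within {0..1})" if "t \<in> {0..1}" for t
    by (rule has_vector_derivative_transform[OF that _ H2_has_vector_derivative[OF assms(2) that]])
      (simp add: assms(1))
  ultimately show ?thesis
    by (intro H2I(1)[of c' "velocity c"])
qed

lemma regular_curve_cong:
  assumes "\<And>t. t \<in> {0..1} \<Longrightarrow> c t = c' t" "regular_curve c"
  shows "regular_curve c'"
  using assms H2_cong[of c c'] velocity_cong[of c c'] unfolding regular_curve_def by auto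

lemma outer_tangent_cong:
  assumes "\<And>t. t \<in> {0..1} \<Longrightarrow> c t = c' t" "z \<in> {0, 1}"
  shows "outer_tangent c z = outer_tangent c' z"
  using velocity_cong[of c c' z] assms unfolding outer_tangent_def by auto

lemma regular_curve_not_singular:
  fixes c :: "real \<Rightarrow> 'a::euclidean_space"
  assumes "regular_curve c" shows "\<not> singular_curve c"
proof
  assume "singular_curve c"
  then obtain a where a: "\<And>t. t \<in> {0..1} \<Longrightarrow> c t = a"
    unfolding singular_curve_def constant_on_def by blast
  have "velocity c 0 = velocity (\<lambda>t. a) 0"
    using a by (intro velocity_cong) auto
  also have "\<dots> = 0" by (rule velocity_eqI) (auto intro: derivative_eq_intros)
  finally show False using assms unfolding regular_curve_def by auto
qed

lemma reparametrized_refl: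
  assumes "\<And>t. t \<in> {0..1} \<Longrightarrow> c' t = c t"
  shows "reparametrized c c'"
proof -
  have d: "((\<lambda>t::real. t) has_vector_derivative 1) (at t within {0..1})" for t
    by (rule has_vector_derivative_id)
  have "has_L2_derivative (\<lambda>t. 1 :: real) (\<lambda>t. 0)"
    by (rule has_L2_derivative_C1) auto
  then have "H2 (\<lambda>t::real. t)" by (rule H2I(1)[OF d])
  then have "reparametrization (\<lambda>t. t)"
    unfolding reparametrization_def using velocity_eqI[OF d] by simp
  then show ?thesis unfolding reparametrized_def using assms by auto
qed

lemma H2_norm_le:
  fixes c :: "real \<Rightarrow> 'a::euclidean_space"
  assumes g: "has_L2_derivative (velocity c) g" and B: "0 \<le> B"
    and le: "\<And>t. t \<in> {0..1} \<Longrightarrow> norm (c t) \<le> B" "\<And>t. t \<in> {0..1} \<Longrightarrow> norm (velocity c t) \<le> B"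
      "\<And>t. t \<in> {0..1} \<Longrightarrow> norm (g t) \<le> B"
  shows "H2_norm c \<le> 2 * B"
proof -
  have "AE t in unit_lebesgue. (norm (L2_derivative (velocity c) t))\<^sup>2 \<le> B\<^sup>2"
    using L2_derivative_AE_eq(1)[OF g] by (rule lebesgue_on_mono) (use le(3) in \<open>auto intro!: power_mono\<close>)
  then have "H2_norm c \<le> sqrt (B\<^sup>2 + B\<^sup>2 + B\<^sup>2)"
    unfolding H2_norm_def using le
    by (intro real_sqrt_le_mono add_mono LINT_unit_le LINT_unit_le_AE) (auto intro!: power_mono)
  also have "\<dots> \<le> sqrt ((2 * B)\<^sup>2)"
    by (intro real_sqrt_le_mono) (simp add: power2_eq_square)
  also have "\<dots> = 2 * B" using B by (intro real_sqrt_unique) simp_all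
  finally show ?thesis .
qed

section \<open>Elastic energy of a curve\<close>

text \<open>The contribution of one edge to the energy. It vanishes on a singular curve, whose velocity is
  zero, so that the energy of a network is a sum over all edges, whether or not they are singular.\<close>

definition elastic_energy :: "(real \<Rightarrow> 'a::euclidean_space) \<Rightarrow> real" where
  "elastic_energy c = arclength_integral c (\<lambda>t. (norm (curvature c t))\<^sup>2) + curve_length c"

lemma elastic_energy_cong:
  assumes "\<And>t. t \<in> {0..1} \<Longrightarrow> c t = c' t"
  shows "elastic_energy c = elastic_energy c'"
proof -
  have v: "velocity c t = velocity c' t" if "t \<in> {0..1}" for t
    using assms that by (rule velocity_cong)
  have "has_L2_derivative (unit_tangent c) = has_L2_derivative (unit_tangent c')"
    by (rule ext, rule has_L2_derivative_cong) (auto simp: unit_tangent_def v)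
  then have "L2_derivative (unit_tangent c) = L2_derivative (unit_tangent c')"
    unfolding L2_derivative_def by simp
  then show ?thesis
    unfolding elastic_energy_def arclength_integral_def curve_length_def curvature_def
    by (intro arg_cong2[where f="(+)"] Bochner_Integration.integral_cong) (auto simp: v)
qed

lemma elastic_energy_singular:
  assumes "singular_curve c" shows "elastic_energy c = 0"
proof -
  obtain x where "\<And>t. t \<in> {0..1} \<Longrightarrow> c t = x"
    using assms unfolding singular_curve_def constant_on_def by blast
  then have "velocity c t = velocity (\<lambda>t. x) t" if "t \<in> {0..1}" for t
    using that by (intro velocity_cong) auto
  moreover have "velocity (\<lambda>t. x) t = 0" if "t \<in> {0..1}" for t
    using that by (intro velocity_eqI has_vector_derivative_const)
  ultimately have "arclength_integral c f = 0" for f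
    unfolding arclength_integral_def by (intro integral_eq_zero_AE AE_I2) auto
  then show ?thesis unfolding elastic_energy_def curve_length_def by simp
qed

lemma energy_eq_sum_elastic_energy:
  "energy N r \<Gamma> = (\<Sum>i\<in>{1..N}. elastic_energy (edge_curve r \<Gamma> i))"
proof -
  have "energy N r \<Gamma> = (\<Sum>i\<in>{1..N} - Sing r {1..N} \<Gamma>. elastic_energy (edge_curve r \<Gamma> i))"
    unfolding energy_def elastic_energy_def ..
  also have "\<dots> = (\<Sum>i\<in>{1..N}. elastic_energy (edge_curve r \<Gamma> i))"
    by (rule sum.mono_neutral_left) (auto simp: Sing_def elastic_energy_singular)
  finally show ?thesis .
qed

text \<open>An expression without weak derivatives of the unit tangent, hence suited to passing to the limit: with
  \<open>u\<close> the velocity and \<open>g\<close> its weak derivative, the squared curvature times the speed is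
  \<open>|sgn_derivative u g|\<^sup>2 / |u|\<close>.\<close>

lemma elastic_energy_eq:
  fixes c :: "real \<Rightarrow> 'a::euclidean_space"
  assumes c: "regular_curve c" and g: "has_L2_derivative (velocity c) g"
  shows "elastic_energy c =
    (LINT t|unit_lebesgue. (norm (sgn_derivative (velocity c t) (g t)))\<^sup>2 / norm (velocity c t))
    + (LINT t|unit_lebesgue. norm (velocity c t))"
proof -
  have nz: "velocity c t \<noteq> 0" if "t \<in> {0..1}" for t using c that unfolding regular_curve_def by auto
  have T: "has_L2_derivative (unit_tangent c) (\<lambda>t. sgn_derivative (velocity c t) (g t))"
    unfolding unit_tangent_def[abs_def] using g nz by (rule has_L2_derivative_sgn)
  have [measurable]: "velocity c \<in> borel_measurable unit_lebesgue"
    by (intro continuous_imp_measurable_on_sets_lebesgue has_L2_derivative_continuous_on[OF g]) simp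
  have [measurable]: "(\<lambda>t. sgn_derivative (velocity c t) (g t)) \<in> borel_measurable unit_lebesgue"
    "L2_derivative (unit_tangent c) \<in> borel_measurable unit_lebesgue"
    using T L2_derivative_AE_eq(2)[OF T] unfolding has_L2_derivative_def by blast+
  have "arclength_integral c (\<lambda>t. (norm (curvature c t))\<^sup>2) =
    (LINT t|unit_lebesgue. (norm (sgn_derivative (velocity c t) (g t)))\<^sup>2 / norm (velocity c t))"
    unfolding arclength_integral_def
  proof (rule integral_cong_AE)
    show "AE t in unit_lebesgue. (norm (curvature c t))\<^sup>2 * norm (velocity c t) =
       (norm (sgn_derivative (velocity c t) (g t)))\<^sup>2 / norm (velocity c t)"
      using L2_derivative_AE_eq(1)[OF T]
    proof (rule lebesgue_on_mono)
      fix t :: real assume "L2_derivative (unit_tangent c) t = sgn_derivative (velocity c t) (g t)" "t \<in> {0..1}"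
      then show "(norm (curvature c t))\<^sup>2 * norm (velocity c t) =
       (norm (sgn_derivative (velocity c t) (g t)))\<^sup>2 / norm (velocity c t)"
        using nz[of t] unfolding curvature_def by (simp add: power_mult_distrib power2_eq_square field_simps)
    qed
  qed (simp_all add: curvature_def)
  then show ?thesis
    unfolding elastic_energy_def curve_length_def arclength_integral_def by simp
qed

section \<open>Tangents of straight segments\<close>

text \<open>The curve never leaves its segment, so all difference quotients at an end point are nonnegative
  multiples of \<open>c 1 - c 0\<close>. These form a closed set, so the velocity at the end points is such a
  multiple too, whatever the parametrization is. It is nonzero since the curve is regular.\<close>

lemma straight_segment_tangents:
  fixes c :: "real \<Rightarrow> 'a::euclidean_space"
  assumes c: "regular_curve c" and s: "straight_segment c"
  shows "outer_tangent c 0 = sgn (c 1 - c 0)" and "outer_tangent c 1 = - sgn (c 1 - c 0)"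
    and "c 0 \<noteq> c 1"
proof -
  define b where "b = c 1 - c 0"
  (* For b \<noteq> 0 the ray spanned by b, written as an equation between continuous functions of w. *)
  define ray where "ray = {w. norm b *\<^sub>R w = norm w *\<^sub>R b}"
  have closed: "closed ray"
    unfolding ray_def by (intro closed_Collect_eq continuous_intros)
  have scale: "l *\<^sub>R b \<in> ray" if "l \<ge> 0" for l
    using that unfolding ray_def by (simp add: mult_ac)
  have on_seg: "\<exists>l. 0 \<le> l \<and> l \<le> 1 \<and> c t = c 0 + l *\<^sub>R b" if "t \<in> {0..1}" for t
  proof -
    have "c t \<in> closed_segment (c 0) (c 1)"
      using s that unfolding straight_segment_def path_image_def pathstart_def pathfinish_def by blast
    then show ?thesis
      unfolding closed_segment_def b_def by (auto simp: algebra_simps)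
  qed
  show ne: "c 0 \<noteq> c 1"
  proof
    assume "c 0 = c 1"
    then have "\<forall>t\<in>{0..1}. c t = c 0" using on_seg by (force simp: b_def)
    then have "singular_curve c" unfolding singular_curve_def constant_on_def by blast
    then show False using regular_curve_not_singular[OF c] by blast
  qed
  have sgn_eq: "sgn w = sgn b" if "w \<in> ray" "w \<noteq> 0" for w
  proof -
    have "sgn w = (inverse (norm b) * inverse (norm w)) *\<^sub>R (norm b *\<^sub>R w)"
      using ne by (simp add: sgn_div_norm b_def)
    also have "\<dots> = (inverse (norm b) * inverse (norm w)) *\<^sub>R (norm w *\<^sub>R b)"
      using that by (simp add: ray_def)
    also have "\<dots> = sgn b" using that by (simp add: sgn_div_norm)
    finally show ?thesis .
  qed
  have d: "((\<lambda>y. (c y - c z) /\<^sub>R (y - z)) \<longlongrightarrow> velocity c z) (at z within {0..1})" if "z \<in> {0, 1}" for z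
  proof -
    have "((\<lambda>y. norm (c y - c z - (y - z) *\<^sub>R velocity c z) / norm (y - z)) \<longlongrightarrow> 0) (at z within {0..1})"
      using H2_has_vector_derivative[of c z] c that
      unfolding has_vector_derivative_def has_derivative_iff_norm regular_curve_def by auto
    moreover have "\<forall>\<^sub>F y in at z within {0..1}. norm (c y - c z - (y - z) *\<^sub>R velocity c z) / norm (y - z) =
        norm ((c y - c z) /\<^sub>R (y - z) - velocity c z)"
      unfolding eventually_at_filter
    proof (rule always_eventually, intro allI impI)
      fix y assume "y \<noteq> z"
      then have "(c y - c z) /\<^sub>R (y - z) - velocity c z = (c y - c z - (y - z) *\<^sub>R velocity c z) /\<^sub>R (y - z)"
        by (simp add: scaleR_diff_right)
      then show "norm (c y - c z - (y - z) *\<^sub>R velocity c z) / norm (y - z) =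
        norm ((c y - c z) /\<^sub>R (y - z) - velocity c z)"
        by (simp add: divide_inverse_commute)
    qed
    ultimately have "((\<lambda>y. norm ((c y - c z) /\<^sub>R (y - z) - velocity c z)) \<longlongrightarrow> 0) (at z within {0..1})"
      by (rule Lim_transform_eventually)
    then show ?thesis
      by (rule LIM_zero_cancel[OF tendsto_norm_zero_cancel])
  qed
  have v: "velocity c z \<in> ray" if z: "z \<in> {0, 1}" for z
  proof (rule Lim_in_closed_set[OF closed _ _ d[OF z]])
    show "\<not> trivial_limit (at z within {0..1})"
      using z by (auto simp: trivial_limit_within islimpt_Icc)
    show "\<forall>\<^sub>F y in at z within {0..1}. (c y - c z) /\<^sub>R (y - z) \<in> ray"
      unfolding eventually_at
    proof (intro exI[of _ 1] conjI ballI impI)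
      fix y :: real assume y: "y \<in> {0..1}" "y \<noteq> z \<and> dist y z < 1"
      obtain l where l: "0 \<le> l" "l \<le> 1" "c y = c 0 + l *\<^sub>R b" using on_seg y by blast
      from z consider "z = 0" | "z = 1" by blast
      then show "(c y - c z) /\<^sub>R (y - z) \<in> ray"
      proof cases
        case 1
        then have "(c y - c z) /\<^sub>R (y - z) = (l / y) *\<^sub>R b" using l by (simp add: divide_inverse_commute)
        then show ?thesis using scale[of "l / y"] l y by simp
      next
        case 2
        have "c y - c 1 = (l - 1) *\<^sub>R b" using l by (simp add: b_def algebra_simps)
        then have "(c y - c z) /\<^sub>R (y - z) = ((l - 1) / (y - 1)) *\<^sub>R b" using 2 by (simp add: divide_inverse_commute)
        then show ?thesis using scale[of "(l - 1) / (y - 1)"] l y by (simp add: divide_nonpos_nonpos)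
      qed
    qed simp
  qed
  have nz: "velocity c z \<noteq> 0" if "z \<in> {0, 1}" for z
    using c that unfolding regular_curve_def by auto
  show "outer_tangent c 0 = sgn (c 1 - c 0)" "outer_tangent c 1 = - sgn (c 1 - c 0)"
    using sgn_eq[OF v nz] unfolding outer_tangent_def b_def by simp_all
qed

section \<open>Cubic corrections of the end points\<close>

text \<open>The cubic that rises from 0 to 1 with zero derivative at both ends.\<close>

definition smoothstep :: "real \<Rightarrow> real" where
  "smoothstep t = 3 * t\<^sup>2 - 2 * t ^ 3"

text \<open>\<open>P\<close> prescribes the initial point and \<open>Q\<close> the velocity at both ends. \<open>R\<close> then adjusts the final
  point without affecting the velocities at the ends.\<close>

definition cubic :: "'a::real_vector \<Rightarrow> 'a \<Rightarrow> 'a \<Rightarrow> real \<Rightarrow> 'a" where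
  "cubic P Q R t = P + t *\<^sub>R Q + smoothstep t *\<^sub>R R"

lemma smoothstep_0 [simp]: "smoothstep 0 = 0" and smoothstep_1 [simp]: "smoothstep 1 = 1"
  by (simp_all add: smoothstep_def)

lemma abs_smoothstep_le:
  assumes "t \<in> {0..1}"
  shows "\<bar>smoothstep t\<bar> \<le> 1"
proof -
  have "smoothstep t = t\<^sup>2 * (3 - 2 * t)" "1 - smoothstep t = (1 - t)\<^sup>2 * (1 + 2 * t)"
    by (simp_all add: smoothstep_def power2_eq_square power3_eq_cube algebra_simps)
  moreover have "t\<^sup>2 * (3 - 2 * t) \<ge> 0" "(1 - t)\<^sup>2 * (1 + 2 * t) \<ge> 0"
    using assms by (intro mult_nonneg_nonneg; simp)+
  ultimately show ?thesis by linarith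
qed

lemma abs_smoothstep_deriv_le:
  fixes t :: real assumes "t \<in> {0..1}"
  shows "\<bar>6 * t - 6 * t\<^sup>2\<bar> \<le> 2"
proof -
  have "6 * t - 6 * t\<^sup>2 = 6 * (t * (1 - t))" "2 - (6 * t - 6 * t\<^sup>2) = 6 * (t - 1/2)\<^sup>2 + 1/2"
    by (simp_all add: power2_eq_square algebra_simps)
  moreover have "6 * (t * (1 - t)) \<ge> 0" "6 * (t - 1/2)\<^sup>2 + 1/2 \<ge> 0"
    using assms by auto
  ultimately show ?thesis by linarith
qed

lemma cubic_has_vector_derivative:
  fixes P :: "'a::real_normed_vector"
  shows "(cubic P Q R has_vector_derivative Q + (6 * t - 6 * t\<^sup>2) *\<^sub>R R) (at t within S)"
  unfolding cubic_def[abs_def] smoothstep_def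
  by (auto intro!: derivative_eq_intros simp: power2_eq_square algebra_simps)

lemma cubic_velocity_has_L2_derivative:
  fixes Q :: "'a::euclidean_space"
  shows "has_L2_derivative (\<lambda>t. Q + (6 * t - 6 * t\<^sup>2) *\<^sub>R R) (\<lambda>t. (6 - 12 * t) *\<^sub>R R)"
proof (rule has_L2_derivative_C1)
  show "((\<lambda>t. Q + (6 * t - 6 * t\<^sup>2) *\<^sub>R R) has_vector_derivative (6 - 12 * t) *\<^sub>R R) (at t within {0..1})" for t
    by (auto intro!: derivative_eq_intros simp: algebra_simps)
  show "continuous_on {0..1} (\<lambda>t. (6 - 12 * t) *\<^sub>R R)"
    by (intro continuous_intros)
qed

lemma perturbed_curve:
  fixes c :: "real \<Rightarrow> 'a::euclidean_space"
  assumes c: "H2 c" and g: "has_L2_derivative (velocity c) g"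
  shows "H2 (\<lambda>t. c t + cubic P Q R t)"
    and "has_L2_derivative (velocity (\<lambda>t. c t + cubic P Q R t)) (\<lambda>t. g t + (6 - 12 * t) *\<^sub>R R)"
    and "t \<in> {0..1} \<Longrightarrow> velocity (\<lambda>t. c t + cubic P Q R t) t = velocity c t + (Q + (6 * t - 6 * t\<^sup>2) *\<^sub>R R)"
proof -
  have d: "((\<lambda>t. c t + cubic P Q R t) has_vector_derivative velocity c t + (Q + (6 * t - 6 * t\<^sup>2) *\<^sub>R R)) (at t within {0..1})"
    if "t \<in> {0..1}" for t
    by (rule has_vector_derivative_add[OF H2_has_vector_derivative[OF c that] cubic_has_vector_derivative])
  have v: "has_L2_derivative (\<lambda>t. velocity c t + (Q + (6 * t - 6 * t\<^sup>2) *\<^sub>R R)) (\<lambda>t. g t + (6 - 12 * t) *\<^sub>R R)"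
    by (rule has_L2_derivative_add[OF g cubic_velocity_has_L2_derivative])
  show "H2 (\<lambda>t. c t + cubic P Q R t)"
    using d v by (rule H2I(1))
  show "has_L2_derivative (velocity (\<lambda>t. c t + cubic P Q R t)) (\<lambda>t. g t + (6 - 12 * t) *\<^sub>R R)"
    using d v by (rule H2I(2))
  show "t \<in> {0..1} \<Longrightarrow> velocity (\<lambda>t. c t + cubic P Q R t) t = velocity c t + (Q + (6 * t - 6 * t\<^sup>2) *\<^sub>R R)"
    using d by (rule velocity_eqI)
qed

lemma H2_cubic: "H2 (cubic P Q R)"
  and cubic_has_L2_derivative: "has_L2_derivative (velocity (cubic P Q R)) (\<lambda>t. (6 - 12 * t) *\<^sub>R R)"
  and velocity_cubic: "t \<in> {0..1} \<Longrightarrow> velocity (cubic P Q R) t = Q + (6 * t - 6 * t\<^sup>2) *\<^sub>R R"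
  for P Q R :: "'a::euclidean_space"
proof -
  show "H2 (cubic P Q R)" "has_L2_derivative (velocity (cubic P Q R)) (\<lambda>t. (6 - 12 * t) *\<^sub>R R)"
    by (rule H2I[OF cubic_has_vector_derivative cubic_velocity_has_L2_derivative])+
  show "t \<in> {0..1} \<Longrightarrow> velocity (cubic P Q R) t = Q + (6 * t - 6 * t\<^sup>2) *\<^sub>R R"
    by (rule velocity_eqI[OF cubic_has_vector_derivative])
qed

lemma norm_cubic_velocity_le:
  fixes Q :: "'a::real_normed_vector"
  assumes "t \<in> {0..1}"
  shows "norm (Q + (6 * t - 6 * t\<^sup>2) *\<^sub>R R) \<le> norm Q + 2 * norm R"
  using mult_right_mono[OF abs_smoothstep_deriv_le[OF assms] norm_ge_zero[of R]]
  by (intro norm_triangle_le add_left_mono) simp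

lemma norm_cubic_acceleration_le:
  fixes R :: "'a::real_normed_vector"
  assumes "t \<in> {0..1}"
  shows "norm ((6 - 12 * t) *\<^sub>R R) \<le> 6 * norm R"
  using assms by (auto intro!: mult_right_mono)

lemma norm_cubic_le:
  fixes P :: "'a::real_normed_vector"
  assumes "t \<in> {0..1}"
  shows "norm (cubic P Q R t) \<le> norm P + norm Q + norm R"
proof -
  have "norm (cubic P Q R t) \<le> norm P + \<bar>t\<bar> * norm Q + \<bar>smoothstep t\<bar> * norm R"
    unfolding cubic_def by (metis norm_triangle_mono norm_triangle_ineq norm_scaleR order_refl)
  also have "\<dots> \<le> norm P + 1 * norm Q + 1 * norm R"
    using assms abs_smoothstep_le[OF assms] by (intro add_mono mult_right_mono) auto
  finally show ?thesis by simp
qed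

lemma H2_norm_cubic_le:
  fixes P :: "'a::euclidean_space"
  shows "H2_norm (cubic P Q R) \<le> 2 * (norm P + norm Q + 6 * norm R)"
proof (rule H2_norm_le[OF cubic_has_L2_derivative])
  fix t :: real assume t: "t \<in> {0..1}"
  show "norm (cubic P Q R t) \<le> norm P + norm Q + 6 * norm R"
    using norm_cubic_le[OF t, of P Q R] norm_ge_zero[of R] by linarith
  show "norm (velocity (cubic P Q R) t) \<le> norm P + norm Q + 6 * norm R"
    unfolding velocity_cubic[OF t]
    using norm_cubic_velocity_le[OF t, of Q R] norm_ge_zero[of P] norm_ge_zero[of R] by linarith
  show "norm ((6 - 12 * t) *\<^sub>R R) \<le> norm P + norm Q + 6 * norm R"
    using norm_cubic_acceleration_le[OF t, of R] norm_ge_zero[of P] norm_ge_zero[of Q] by linarith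
qed simp

text \<open>The cubics form a finite dimensional space, on which the \<open>H\<^sup>2\<close> norm is controlled by the coefficients.\<close>

lemma H2_norm_cubic_tendsto:
  fixes P Q R :: "nat \<Rightarrow> 'a::euclidean_space"
  assumes "P \<longlonglongrightarrow> 0" "Q \<longlonglongrightarrow> 0" "R \<longlonglongrightarrow> 0"
  shows "(\<lambda>n. H2_norm (cubic (P n) (Q n) (R n))) \<longlonglongrightarrow> 0"
proof (rule tendsto_sandwich)
  show "\<forall>\<^sub>F n in sequentially. 0 \<le> H2_norm (cubic (P n) (Q n) (R n))"
    unfolding H2_norm_def by (intro always_eventually allI real_sqrt_ge_zero add_nonneg_nonneg integral_nonneg_AE) auto
  show "\<forall>\<^sub>F n in sequentially. H2_norm (cubic (P n) (Q n) (R n)) \<le> 2 * (norm (P n) + norm (Q n) + 6 * norm (R n))"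
    by (intro always_eventually allI H2_norm_cubic_le)
  show "(\<lambda>n. 2 * (norm (P n) + norm (Q n) + 6 * norm (R n))) \<longlonglongrightarrow> 0"
    using assms by (auto intro!: tendsto_eq_intros)
qed simp

section \<open>Convergence of the elastic energy\<close>

text \<open>The integrand of the curvature energy scales like \<open>|v|\<^sup>2 / |x|\<^sup>3\<close> in the acceleration \<open>v\<close> and the
  velocity \<open>x\<close>. The exponent 3 decides how fast the scales of the construction have to decrease.\<close>

lemma curvature_density_le:
  assumes "0 < m" "m \<le> norm x" "norm v \<le> B"
  shows "(norm (sgn_derivative x v))\<^sup>2 / norm x \<le> B\<^sup>2 / m ^ 3"
proof -
  have "norm (sgn_derivative x v) \<le> B / m"
    using norm_sgn_derivative_le[of x v] assms frac_le[of B "norm v" m "norm x"]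
    by (meson norm_ge_zero order_trans)
  then have "(norm (sgn_derivative x v))\<^sup>2 / norm x \<le> (B / m)\<^sup>2 / m"
    using assms by (intro frac_le power_mono) auto
  also have "\<dots> = B\<^sup>2 / m ^ 3"
    by (simp add: power_divide power2_eq_square power3_eq_cube)
  finally show ?thesis .
qed

lemma regular_curve_velocity_bounded_below:
  fixes c :: "real \<Rightarrow> 'a::euclidean_space"
  assumes "regular_curve c"
  obtains m where "m > 0" "\<And>t. t \<in> {0..1} \<Longrightarrow> m \<le> norm (velocity c t)"
proof -
  obtain g where g: "has_L2_derivative (velocity c) g"
    using assms unfolding regular_curve_def H2_def H1_def by blast
  have "continuous_on {0..1} (\<lambda>t. norm (velocity c t))"
    by (intro continuous_intros has_L2_derivative_continuous_on[OF g])
  then obtain s where "s \<in> {0..1}" "\<forall>t\<in>{0..1}. norm (velocity c s) \<le> norm (velocity c t)"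
    using continuous_attains_inf[of "{0..1::real}" "\<lambda>t. norm (velocity c t)"] by auto
  then show ?thesis
    using assms unfolding regular_curve_def by (intro that[of "norm (velocity c s)"]) auto
qed

text \<open>A small cubic changes velocity and acceleration uniformly little. The speed of \<open>c\<close> is bounded
  below, so the perturbed speeds are as well, and the energy densities are dominated by
  \<open>|g|\<^sup>2\<close> up to additive and multiplicative constants, where \<open>g\<close> is the weak derivative of the velocity of \<open>c\<close>.\<close>

lemma elastic_energy_perturbed:
  fixes c :: "real \<Rightarrow> 'a::euclidean_space"
  assumes c: "regular_curve c" and Q: "Q \<longlonglongrightarrow> 0" and R: "R \<longlonglongrightarrow> 0"
  shows "\<forall>\<^sub>F n in sequentially. regular_curve (\<lambda>t. c t + cubic (P n) (Q n) (R n) t)"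
    and "(\<lambda>n. elastic_energy (\<lambda>t. c t + cubic (P n) (Q n) (R n) t)) \<longlonglongrightarrow> elastic_energy c"
proof -
  define C where "C n t = c t + cubic (P n) (Q n) (R n) t" for n t
  obtain g where g: "has_L2_derivative (velocity c) g" and H2c: "H2 c"
    using c unfolding regular_curve_def H2_def H1_def by blast
  obtain m where m: "m > 0" "\<And>t. t \<in> {0..1} \<Longrightarrow> m \<le> norm (velocity c t)"
    using c by (rule regular_curve_velocity_bounded_below) blast
  define v where "v n t = velocity c t + (Q n + (6 * t - 6 * t\<^sup>2) *\<^sub>R R n)" for n t
  define a where "a n t = g t + (6 - 12 * t) *\<^sub>R R n" for n t
  have H2C: "H2 (C n)" and aC: "has_L2_derivative (velocity (C n)) (a n)"
    and vC: "t \<in> {0..1} \<Longrightarrow> velocity (C n) t = v n t" for n t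
    unfolding C_def[abs_def] a_def v_def by (rule perturbed_curve[OF H2c g])+
  have "(\<lambda>n. norm (Q n) + 2 * norm (R n)) \<longlonglongrightarrow> 0" "(\<lambda>n. norm (R n)) \<longlonglongrightarrow> 0"
    using Q R by (auto intro!: tendsto_eq_intros)
  (* From n0 on, the speeds are at least m / 2 and the accelerations change by at most 6. *)
  then have "\<forall>\<^sub>F n in sequentially. norm (Q n) + 2 * norm (R n) < m / 2 \<and> norm (R n) < 1"
    using m by (intro eventually_conj order_tendstoD(2)[of _ 0]) auto
  then obtain n0 where n0: "\<And>n. n \<ge> n0 \<Longrightarrow> norm (Q n) + 2 * norm (R n) < m / 2"
      "\<And>n. n \<ge> n0 \<Longrightarrow> norm (R n) < 1"
    unfolding eventually_sequentially by blast
  have diff: "norm (v n t - velocity c t) \<le> m / 2" if "n \<ge> n0" "t \<in> {0..1}" for n t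
    using norm_cubic_velocity_le[OF that(2), of "Q n" "R n"] n0(1)[OF that(1)] unfolding v_def by simp
  have v_lower: "m / 2 \<le> norm (v n t)" if "n \<ge> n0" "t \<in> {0..1}" for n t
    using diff[OF that] m(2)[OF that(2)] norm_triangle_ineq2[of "velocity c t" "v n t"]
    by (simp add: norm_minus_commute)
  have v_upper: "norm (v n t) \<le> norm (velocity c t) + m / 2" if "n \<ge> n0" "t \<in> {0..1}" for n t
    using diff[OF that] norm_triangle_ineq2[of "v n t" "velocity c t"] by simp
  have regC: "regular_curve (C n)" if "n \<ge> n0" for n
    using H2C[of n] v_lower[OF that] vC m(1) unfolding regular_curve_def by force
  then show "\<forall>\<^sub>F n in sequentially. regular_curve (\<lambda>t. c t + cubic (P n) (Q n) (R n) t)"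
    unfolding eventually_sequentially C_def[abs_def] by blast
  have E: "elastic_energy (C n) =
      (LINT t|unit_lebesgue. (norm (sgn_derivative (v n t) (a n t)))\<^sup>2 / norm (v n t)) +
      (LINT t|unit_lebesgue. norm (v n t))" if "n \<ge> n0" for n
    unfolding elastic_energy_eq[OF regC[OF that] aC]
    by (intro arg_cong2[where f = "(+)"] Bochner_Integration.integral_cong) (auto simp: vC)
  have g2: "integrable unit_lebesgue (\<lambda>t. (norm (g t))\<^sup>2)"
    using g unfolding has_L2_derivative_def by blast
  have cont_v: "continuous_on {0..1} (velocity c)" "continuous_on {0..1} (v n)" for n
    using has_L2_derivative_continuous_on[OF g]
    by (auto intro: continuous_on_eq[OF has_L2_derivative_continuous_on[OF aC] vC])
  then have [measurable]: "velocity c \<in> borel_measurable unit_lebesgue" "v n \<in> borel_measurable unit_lebesgue" for n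
    by (auto intro!: continuous_imp_measurable_on_sets_lebesgue)
  have nz: "velocity c t \<noteq> 0" if "t \<in> {0..1}" for t using m that by force
  have [measurable]: "(\<lambda>t. sgn_derivative (velocity c t) (g t)) \<in> borel_measurable unit_lebesgue"
    using has_L2_derivative_sgn[OF g nz] unfolding has_L2_derivative_def by blast
  have [measurable]: "(\<lambda>t. sgn_derivative (v (n + n0) t) (a (n + n0) t)) \<in> borel_measurable unit_lebesgue" for n
  proof -
    have "has_L2_derivative (v (n + n0)) (a (n + n0))"
      using aC[of "n + n0"] vC by (subst has_L2_derivative_cong[symmetric]) auto
    moreover have "v (n + n0) t \<noteq> 0" if "t \<in> {0..1}" for t
      using v_lower[of "n + n0" t] m(1) that by force
    ultimately show ?thesis
      using has_L2_derivative_sgn[of "v (n + n0)" "a (n + n0)"] unfolding has_L2_derivative_def by blast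
  qed
  have R': "(\<lambda>n. R (n + n0)) \<longlonglongrightarrow> 0" and Q': "(\<lambda>n. Q (n + n0)) \<longlonglongrightarrow> 0"
    using Q R by (auto intro: LIMSEQ_ignore_initial_segment)
  have v_lim: "(\<lambda>n. v (n + n0) t) \<longlonglongrightarrow> velocity c t" and a_lim: "(\<lambda>n. a (n + n0) t) \<longlonglongrightarrow> g t" for t
    unfolding v_def a_def using R' Q' by (auto intro!: tendsto_eq_intros)
  have lim1: "(\<lambda>n. LINT t|unit_lebesgue. (norm (sgn_derivative (v (n + n0) t) (a (n + n0) t)))\<^sup>2 / norm (v (n + n0) t))
    \<longlonglongrightarrow> (LINT t|unit_lebesgue. (norm (sgn_derivative (velocity c t) (g t)))\<^sup>2 / norm (velocity c t))"
  proof (rule integral_dominated_convergence)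
    show "integrable unit_lebesgue (\<lambda>t. (2 * (norm (g t))\<^sup>2 + 72) / (m / 2) ^ 3)"
      using g2 finite_measure.integrable_const[OF finite_measure_unit_lebesgue] by auto
    show "AE t in unit_lebesgue. (\<lambda>n. (norm (sgn_derivative (v (n + n0) t) (a (n + n0) t)))\<^sup>2 / norm (v (n + n0) t))
       \<longlonglongrightarrow> (norm (sgn_derivative (velocity c t) (g t)))\<^sup>2 / norm (velocity c t)"
      unfolding sgn_derivative_def sgn_div_norm
      using nz by (intro AE_I2 tendsto_intros v_lim a_lim) auto
    show "AE t in unit_lebesgue. norm ((norm (sgn_derivative (v (n + n0) t) (a (n + n0) t)))\<^sup>2 / norm (v (n + n0) t))
       \<le> (2 * (norm (g t))\<^sup>2 + 72) / (m / 2) ^ 3" for n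
    proof (rule AE_I2)
      fix t assume "t \<in> space unit_lebesgue"
      then have t: "t \<in> {0..1}" by simp
      have "norm (a (n + n0) t) \<le> norm (g t) + 6"
        unfolding a_def using norm_cubic_acceleration_le[OF t, of "R (n + n0)"] n0(2)[of "n + n0"]
        by (intro norm_triangle_le add_left_mono) linarith
      then have "(norm (sgn_derivative (v (n + n0) t) (a (n + n0) t)))\<^sup>2 / norm (v (n + n0) t) \<le> (norm (g t) + 6)\<^sup>2 / (m / 2) ^ 3"
        using m(1) v_lower[of "n + n0" t] t by (intro curvature_density_le) auto
      also have "\<dots> \<le> (2 * (norm (g t))\<^sup>2 + 72) / (m / 2) ^ 3"
        using m(1) zero_le_power2[of "norm (g t) - 6"]
        by (intro divide_right_mono) (auto simp: power2_eq_square algebra_simps)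
      finally show "norm ((norm (sgn_derivative (v (n + n0) t) (a (n + n0) t)))\<^sup>2 / norm (v (n + n0) t))
         \<le> (2 * (norm (g t))\<^sup>2 + 72) / (m / 2) ^ 3" by simp
    qed
  qed measurable
  have lim2: "(\<lambda>n. LINT t|unit_lebesgue. norm (v (n + n0) t)) \<longlonglongrightarrow> (LINT t|unit_lebesgue. norm (velocity c t))"
  proof (rule integral_dominated_convergence)
    show "integrable unit_lebesgue (\<lambda>t. norm (velocity c t) + m / 2)"
      by (intro continuous_imp_integrable_real continuous_intros cont_v)
    show "AE t in unit_lebesgue. (\<lambda>n. norm (v (n + n0) t)) \<longlonglongrightarrow> norm (velocity c t)"
      by (intro AE_I2 tendsto_intros v_lim)
    show "AE t in unit_lebesgue. norm (norm (v (n + n0) t)) \<le> norm (velocity c t) + m / 2" for n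
      using v_upper[of "n + n0"] by (intro AE_I2) auto
  qed measurable
  have "(\<lambda>n. elastic_energy (C (n + n0))) \<longlonglongrightarrow> elastic_energy c"
    unfolding elastic_energy_eq[OF c g] E[OF le_add2] by (rule tendsto_add[OF lim1 lim2])
  then show "(\<lambda>n. elastic_energy (\<lambda>t. c t + cubic (P n) (Q n) (R n) t)) \<longlonglongrightarrow> elastic_energy c"
    unfolding C_def[abs_def] by (rule LIMSEQ_offset)
qed

text \<open>The leading part \<open>t e Q\<close> is straight, hence only the remainder \<open>R\<close> contributes to the
  acceleration. Speeds of order \<open>e\<close> and accelerations of order \<open>e\<^sup>2\<close> give a curvature energy of order
  \<open>e\<^sup>4 / e\<^sup>3 = e\<close>, and the length is of order \<open>e\<close> too.\<close>

lemma elastic_energy_collapsing: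
  fixes Q :: "'a::euclidean_space"
  assumes Q: "Q \<noteq> 0" and e: "\<And>n. 0 < e n" "e \<longlonglongrightarrow> 0" and R: "\<And>n. norm (R n) \<le> K * (e n)\<^sup>2"
  shows "\<forall>\<^sub>F n in sequentially. regular_curve (cubic (P n) (e n *\<^sub>R Q) (R n))"
    and "(\<lambda>n. elastic_energy (cubic (P n) (e n *\<^sub>R Q) (R n))) \<longlonglongrightarrow> 0"
proof -
  define C where "C n = cubic (P n) (e n *\<^sub>R Q) (R n)" for n
  define q where "q = norm Q"
  have q: "q > 0" using Q by (simp add: q_def)
  have vC: "velocity (C n) t = e n *\<^sub>R Q + (6 * t - 6 * t\<^sup>2) *\<^sub>R R n" if "t \<in> {0..1}" for n t
    unfolding C_def by (rule velocity_cubic[OF that])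
  have upper: "norm (velocity (C n) t) \<le> e n * q + 2 * (K * (e n)\<^sup>2)" if "t \<in> {0..1}" for n t
    using norm_cubic_velocity_le[OF that, of "e n *\<^sub>R Q" "R n"] R[of n] e(1)[of n]
    unfolding vC[OF that] q_def by simp
  have "(\<lambda>n. 2 * (K * e n)) \<longlonglongrightarrow> 0"
    using e(2) by (auto intro!: tendsto_eq_intros)
  then have ev: "\<forall>\<^sub>F n in sequentially. 2 * (K * e n) < q / 2"
    using q by (intro order_tendstoD(2)[of _ 0]) auto
  have lower: "e n * q / 2 \<le> norm (velocity (C n) t)" if n: "2 * (K * e n) < q / 2" and t: "t \<in> {0..1}" for n t
  proof -
    have "norm ((6 * t - 6 * t\<^sup>2) *\<^sub>R R n) \<le> 2 * (K * (e n)\<^sup>2)"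
      using norm_cubic_velocity_le[OF t, of 0 "R n"] R[of n] by simp
    also have "\<dots> \<le> e n * (q / 2)"
      using mult_left_mono[OF less_imp_le[OF n], of "e n"] e(1)[of n] by (simp add: power2_eq_square mult_ac)
    finally have "norm (e n *\<^sub>R Q) - e n * (q / 2) \<le> norm (velocity (C n) t)"
      unfolding vC[OF t] using norm_diff_ineq[of "e n *\<^sub>R Q" "(6 * t - 6 * t\<^sup>2) *\<^sub>R R n"] by linarith
    then show ?thesis using e(1)[of n] by (simp add: q_def mult.commute)
  qed
  have reg: "regular_curve (C n)" if "2 * (K * e n) < q / 2" for n
  proof -
    have "velocity (C n) t \<noteq> 0" if "t \<in> {0..1}" for t
      using lower[OF \<open>2 * (K * e n) < q / 2\<close> that] mult_pos_pos[OF e(1)[of n] q] by force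
    then show ?thesis unfolding regular_curve_def C_def using H2_cubic by blast
  qed
  show "\<forall>\<^sub>F n in sequentially. regular_curve (cubic (P n) (e n *\<^sub>R Q) (R n))"
    using ev by (rule eventually_mono) (use reg in \<open>simp add: C_def\<close>)
  have bound: "elastic_energy (C n) \<le> 288 * K\<^sup>2 / q ^ 3 * e n + (e n * q + 2 * (K * (e n)\<^sup>2))"
    if n: "2 * (K * e n) < q / 2" for n
  proof -
    have pos: "0 < e n * q / 2" using e(1)[of n] q by simp
    have nn: "0 \<le> K * (e n)\<^sup>2" using order_trans[OF norm_ge_zero R] .
    have "(LINT t|unit_lebesgue. (norm (sgn_derivative (velocity (C n) t) ((6 - 12 * t) *\<^sub>R R n)))\<^sup>2 / norm (velocity (C n) t))
        \<le> (6 * (K * (e n)\<^sup>2))\<^sup>2 / (e n * q / 2) ^ 3"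
    proof (rule LINT_unit_le)
      fix t :: real assume t: "t \<in> {0..1}"
      have "norm ((6 - 12 * t) *\<^sub>R R n) \<le> 6 * (K * (e n)\<^sup>2)"
        using norm_cubic_acceleration_le[OF t, of "R n"] R[of n] by linarith
      then show "(norm (sgn_derivative (velocity (C n) t) ((6 - 12 * t) *\<^sub>R R n)))\<^sup>2 / norm (velocity (C n) t)
        \<le> (6 * (K * (e n)\<^sup>2))\<^sup>2 / (e n * q / 2) ^ 3"
        using pos lower[OF n t] by (rule curvature_density_le[rotated 2])
    qed (use pos in auto)
    also have "(6 * (K * (e n)\<^sup>2))\<^sup>2 / (e n * q / 2) ^ 3 = 288 * K\<^sup>2 / q ^ 3 * e n"
      using e(1)[of n] q by (simp add: field_simps power2_eq_square power3_eq_cube)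
    finally have "(LINT t|unit_lebesgue. (norm (sgn_derivative (velocity (C n) t) ((6 - 12 * t) *\<^sub>R R n)))\<^sup>2 / norm (velocity (C n) t))
        \<le> 288 * K\<^sup>2 / q ^ 3 * e n" .
    moreover have "(LINT t|unit_lebesgue. norm (velocity (C n) t)) \<le> e n * q + 2 * (K * (e n)\<^sup>2)"
      using upper pos nn by (intro LINT_unit_le) auto
    ultimately show ?thesis
      unfolding elastic_energy_eq[OF reg[OF n] cubic_has_L2_derivative[of "P n" "e n *\<^sub>R Q" "R n", folded C_def]]
      by linarith
  qed
  have "(\<lambda>n. elastic_energy (C n)) \<longlonglongrightarrow> 0"
  proof (rule tendsto_sandwich)
    show "\<forall>\<^sub>F n in sequentially. 0 \<le> elastic_energy (C n)"
      unfolding elastic_energy_def curve_length_def arclength_integral_def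
      by (intro always_eventually allI add_nonneg_nonneg integral_nonneg_AE) auto
    show "\<forall>\<^sub>F n in sequentially. elastic_energy (C n) \<le> 288 * K\<^sup>2 / q ^ 3 * e n + (e n * q + 2 * (K * (e n)\<^sup>2))"
      using ev by (rule eventually_mono) (rule bound)
    show "(\<lambda>n. 288 * K\<^sup>2 / q ^ 3 * e n + (e n * q + 2 * (K * (e n)\<^sup>2))) \<longlonglongrightarrow> 0"
      using e(2) q by (auto intro!: tendsto_eq_intros)
  qed simp
  then show "(\<lambda>n. elastic_energy (cubic (P n) (e n *\<^sub>R Q) (R n))) \<longlonglongrightarrow> 0"
    unfolding C_def .
qed

section \<open>Recovery sequences for a single edge\<close>

text \<open>A sequence \<open>C\<close> of curves from \<open>a n\<close> to \<open>b n\<close> that approximates \<open>c\<close> in \<open>H\<^sup>2\<close> and in energy,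
  while its outer tangents are \<open>\<sigma>\<close> and \<open>\<tau>\<close> for every \<open>n\<close>. Regularity can only be expected for large
  \<open>n\<close>; the whole network is later restricted to a tail of the sequence.\<close>

definition recovery_curves ::
    "(nat \<Rightarrow> 'a) \<Rightarrow> (nat \<Rightarrow> 'a) \<Rightarrow> 'a \<Rightarrow> 'a \<Rightarrow> (nat \<Rightarrow> real \<Rightarrow> 'a) \<Rightarrow> (real \<Rightarrow> 'a::euclidean_space) \<Rightarrow> bool"
  where
  "recovery_curves a b \<sigma> \<tau> C c \<longleftrightarrow>
     (\<forall>n. C n 0 = a n \<and> C n 1 = b n \<and> outer_tangent (C n) 0 = \<sigma> \<and> outer_tangent (C n) 1 = \<tau>) \<and>
     H2_tendsto C c \<and> (\<forall>\<^sub>F n in sequentially. regular_curve (C n)) \<and>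
     (\<lambda>n. elastic_energy (C n)) \<longlonglongrightarrow> elastic_energy c"

text \<open>The cubic corrections have zero velocity at the ends, so moving the end points of a regular curve
  leaves its outer tangents unchanged.\<close>

lemma recovery_curves_regular:
  fixes c :: "real \<Rightarrow> 'a::euclidean_space"
  assumes c: "regular_curve c" and a: "a \<longlonglongrightarrow> c 0" and b: "b \<longlonglongrightarrow> c 1"
  shows "recovery_curves a b (outer_tangent c 0) (outer_tangent c 1)
    (\<lambda>n t. c t + cubic (a n - c 0) 0 ((b n - c 1) - (a n - c 0)) t) c"
proof -
  obtain g where g: "has_L2_derivative (velocity c) g" and H2c: "H2 c"
    using c unfolding regular_curve_def H2_def H1_def by blast
  define P where "P n = a n - c 0" for n
  define R where "R n = (b n - c 1) - (a n - c 0)" for n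
  define C where "C n t = c t + cubic (P n) 0 (R n) t" for n t
  have P: "P \<longlonglongrightarrow> 0" and R: "R \<longlonglongrightarrow> 0"
    unfolding P_def R_def using a b by (auto intro!: tendsto_eq_intros)
  have ends: "C n 0 = a n" "C n 1 = b n" for n
    unfolding C_def by (simp_all add: cubic_def P_def R_def)
  have vel: "velocity (C n) z = velocity c z" if "z \<in> {0, 1}" for n z
    using perturbed_curve(3)[OF H2c g, of z "P n" 0 "R n"] that unfolding C_def[abs_def] by auto
  have "H2_tendsto C c"
    unfolding H2_tendsto_def C_def
    using H2c perturbed_curve(1)[OF H2c g] H2_norm_cubic_tendsto[OF P tendsto_const R] by simp
  moreover have "\<forall>\<^sub>F n in sequentially. regular_curve (C n)"
      "(\<lambda>n. elastic_energy (C n)) \<longlonglongrightarrow> elastic_energy c"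
    unfolding C_def[abs_def] using elastic_energy_perturbed[OF c tendsto_const R] by blast+
  ultimately have "recovery_curves a b (outer_tangent c 0) (outer_tangent c 1) C c"
    unfolding recovery_curves_def by (simp add: ends vel outer_tangent_def)
  then show ?thesis
    unfolding C_def[abs_def] P_def R_def .
qed

text \<open>An edge that collapses to the point \<open>x\<close> is replaced by a short, almost straight curve. Its end
  points differ by \<open>e n *\<^sub>R Q\<close> up to an error of order \<open>(e n)\<^sup>2\<close>; the cubic correction absorbs this
  error and keeps both end velocities equal to \<open>e n *\<^sub>R Q\<close>.\<close>

lemma recovery_curves_collapsed:
  fixes Q :: "'a::euclidean_space"
  assumes Q: "Q \<noteq> 0" and e: "\<And>n. 0 < e n" "e \<longlonglongrightarrow> 0" and a: "a \<longlonglongrightarrow> x"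
    and b: "\<And>n. norm (b n - a n - e n *\<^sub>R Q) \<le> K * (e n)\<^sup>2"
  shows "recovery_curves a b (sgn Q) (- sgn Q)
    (\<lambda>n. cubic (a n) (e n *\<^sub>R Q) (b n - a n - e n *\<^sub>R Q)) (\<lambda>t. x)"
proof -
  define R where "R n = b n - a n - e n *\<^sub>R Q" for n
  define C where "C n = cubic (a n) (e n *\<^sub>R Q) (R n)" for n
  have "(\<lambda>n. K * (e n)\<^sup>2) \<longlonglongrightarrow> 0" using e(2) by (auto intro!: tendsto_eq_intros)
  then have R: "R \<longlonglongrightarrow> 0"
    by (rule Lim_null_comparison[rotated]) (use b in \<open>simp add: R_def\<close>)
  have ends: "C n 0 = a n" "C n 1 = b n" for n
    unfolding C_def by (simp_all add: cubic_def R_def)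
  have "sgn (e n *\<^sub>R Q) = sgn Q" for n
    using e(1)[of n] by (simp add: sgn_scaleR)
  then have tan: "outer_tangent (C n) 0 = sgn Q" "outer_tangent (C n) 1 = - sgn Q" for n
    unfolding outer_tangent_def C_def by (simp_all add: velocity_cubic)
  have "H2 (cubic x 0 0)" by (rule H2_cubic)
  then have H2x: "H2 (\<lambda>t. x)" by (simp add: cubic_def[abs_def])
  have diff: "(\<lambda>t. C n t - x) = cubic (a n - x) (e n *\<^sub>R Q) (R n)" for n
    by (simp add: fun_eq_iff C_def cubic_def)
  have "(\<lambda>n. a n - x) \<longlonglongrightarrow> 0" "(\<lambda>n. e n *\<^sub>R Q) \<longlonglongrightarrow> 0"
    using a e(2) by (auto intro!: tendsto_eq_intros)
  then have "H2_tendsto C (\<lambda>t. x)"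
    unfolding H2_tendsto_def diff using H2_norm_cubic_tendsto[OF _ _ R] H2x H2_cubic by (auto simp: C_def)
  moreover have "\<forall>\<^sub>F n in sequentially. regular_curve (C n)" "(\<lambda>n. elastic_energy (C n)) \<longlonglongrightarrow> 0"
    unfolding C_def using elastic_energy_collapsing[OF Q e, of R K a] b by (simp_all add: R_def)
  moreover have "elastic_energy (\<lambda>t. x) = 0"
    by (rule elastic_energy_singular) (auto simp: singular_curve_def constant_on_def)
  ultimately have "recovery_curves a b (sgn Q) (- sgn Q) C (\<lambda>t. x)"
    unfolding recovery_curves_def by (simp add: ends tan)
  then show ?thesis
    unfolding C_def R_def .
qed

section \<open>Scales of a stratification\<close>

text \<open>The scale \<open>\<epsilon> ^ 2 ^ Suc k\<close> is the square of the scale \<open>\<epsilon> ^ 2 ^ k\<close>. Thus everything that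
  follows the first nonzero term is quadratically small compared to its scale, which is what
  \<open>recovery_curves_collapsed\<close> asks for.\<close>

lemma multiscale_remainder:
  fixes \<Delta> :: "nat \<Rightarrow> 'a::real_normed_vector"
  assumes \<epsilon>: "0 < \<epsilon>" "\<epsilon> \<le> 1" and j: "j < q" and zero: "\<And>k. k < j \<Longrightarrow> \<Delta> k = 0"
  shows "norm ((\<Sum>k<q. \<epsilon> ^ 2 ^ k *\<^sub>R \<Delta> k) - \<epsilon> ^ 2 ^ j *\<^sub>R \<Delta> j) \<le> (\<Sum>k<q. norm (\<Delta> k)) * (\<epsilon> ^ 2 ^ j)\<^sup>2"
proof -
  have "(\<Sum>k<q. \<epsilon> ^ 2 ^ k *\<^sub>R \<Delta> k) - \<epsilon> ^ 2 ^ j *\<^sub>R \<Delta> j = (\<Sum>k\<in>{..<q} - {j}. \<epsilon> ^ 2 ^ k *\<^sub>R \<Delta> k)"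
    using j by (simp add: sum.remove[of _ j])
  also have "norm \<dots> \<le> (\<Sum>k\<in>{..<q} - {j}. norm (\<Delta> k) * (\<epsilon> ^ 2 ^ j)\<^sup>2)"
  proof (rule sum_norm_le)
    fix k assume k: "k \<in> {..<q} - {j}"
    show "norm (\<epsilon> ^ 2 ^ k *\<^sub>R \<Delta> k) \<le> norm (\<Delta> k) * (\<epsilon> ^ 2 ^ j)\<^sup>2"
    proof (cases "k < j")
      case False
      then have "(2::nat) ^ Suc j \<le> 2 ^ k" using k by (intro power_increasing) auto
      then have "\<epsilon> ^ 2 ^ k \<le> \<epsilon> ^ 2 ^ Suc j" by (rule power_decreasing) (use \<epsilon> in auto)
      also have "\<dots> = (\<epsilon> ^ 2 ^ j)\<^sup>2" by (simp add: power_mult[symmetric] mult.commute)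
      finally show ?thesis using \<epsilon> by (simp add: mult.commute mult_left_mono)
    qed (simp add: zero)
  qed
  also have "\<dots> \<le> (\<Sum>k<q. norm (\<Delta> k) * (\<epsilon> ^ 2 ^ j)\<^sup>2)"
    by (intro sum_mono2) auto
  finally show ?thesis by (simp add: sum_distrib_right)
qed

text \<open>Each edge of the stratified subgraph is constant on the first levels, becomes a regular straight
  segment on exactly one level \<open>j\<close>, and drops out of the later subgraphs. The vector that joins
  the ends of this segment then determines the two tangents. The maps \<open>\<Sigma> k\<close> have arbitrary values
  away from their subgraphs; only the edges that belong to level \<open>k\<close> are described.\<close>

lemma stratified_straight_levels:
  fixes \<tau> :: "point \<Rightarrow> real^'d"
  assumes "stratified_straight N r D S \<tau>"
  obtains q :: nat and \<Sigma> :: "nat \<Rightarrow> point set \<Rightarrow> real^'d" where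
    "\<And>i. i \<in> S \<Longrightarrow> \<exists>j<q. (\<forall>k<j. edge_curve r (\<Sigma> k) i 1 = edge_curve r (\<Sigma> k) i 0) \<and>
       edge_curve r (\<Sigma> j) i 1 \<noteq> edge_curve r (\<Sigma> j) i 0 \<and>
       \<tau> (0, i) = sgn (edge_curve r (\<Sigma> j) i 1 - edge_curve r (\<Sigma> j) i 0) \<and>
       \<tau> (1, i) = - sgn (edge_curve r (\<Sigma> j) i 1 - edge_curve r (\<Sigma> j) i 0)"
proof -
  obtain q :: nat and H :: "nat \<Rightarrow> nat set" and \<Sigma> :: "nat \<Rightarrow> point set \<Rightarrow> real^'d" where
    H: "H 0 = S" "H q = {}" and
    step: "\<And>j. j < q \<Longrightarrow> network N r (H j) (\<Sigma> j)"
      "\<And>j. j < q \<Longrightarrow> angle_condition r D (H j) (\<Sigma> j) \<tau>"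
      "\<And>j i. j < q \<Longrightarrow> i \<in> H j \<Longrightarrow> regular_curve (edge_curve r (\<Sigma> j) i) \<Longrightarrow> straight_segment (edge_curve r (\<Sigma> j) i)"
      "\<And>j. j < q \<Longrightarrow> H (Suc j) = Sing r (H j) (\<Sigma> j)"
    using assms unfolding stratified_straight_def by metis
  show thesis
  proof (rule that[of q \<Sigma>])
    fix i assume i: "i \<in> S"
    (* The level after the one on which the edge is regular. *)
    define m where "m = (LEAST m. i \<notin> H m)"
    have "i \<notin> H q" using H by simp
    then have m: "i \<notin> H m" "m \<le> q"
      unfolding m_def by (rule LeastI, rule Least_le)
    have below: "i \<in> H k" if "k < m" for k
      using not_less_Least[of k "\<lambda>m. i \<notin> H m"] that unfolding m_def by blast
    have "m \<noteq> 0" using m(1) i H(1) by metis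
    then obtain j where j: "m = Suc j" using not0_implies_Suc by blast
    have jq: "j < q" and ij: "i \<in> H j" using m(2) j below by auto
    let ?c = "edge_curve r (\<Sigma> j) i"
    have ns: "\<not> singular_curve ?c"
      using step(4)[OF jq] ij m(1) unfolding j Sing_def by blast
    then have reg: "regular_curve ?c"
      using step(1)[OF jq] ij unfolding network_def by blast
    have tau: "\<tau> (z, i) = outer_tangent ?c z" if "z \<in> {0, 1}" for z
      using step(2)[OF jq] ij ns that unfolding angle_condition_def tangents_def by metis
    have "edge_curve r (\<Sigma> k) i 1 = edge_curve r (\<Sigma> k) i 0" if "k < j" for k
    proof -
      have "i \<in> H (Suc k)" using below that j by simp
      then have "singular_curve (edge_curve r (\<Sigma> k) i)"
        using step(4)[of k] that jq unfolding Sing_def by simp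
      then show ?thesis unfolding singular_curve_def constant_on_def by auto
    qed
    with jq straight_segment_tangents[OF reg step(3)[OF jq ij reg]] tau[of 0] tau[of 1]
    show "\<exists>j<q. (\<forall>k<j. edge_curve r (\<Sigma> k) i 1 = edge_curve r (\<Sigma> k) i 0) \<and>
       edge_curve r (\<Sigma> j) i 1 \<noteq> edge_curve r (\<Sigma> j) i 0 \<and>
       \<tau> (0, i) = sgn (edge_curve r (\<Sigma> j) i 1 - edge_curve r (\<Sigma> j) i 0) \<and>
       \<tau> (1, i) = - sgn (edge_curve r (\<Sigma> j) i 1 - edge_curve r (\<Sigma> j) i 0)"
      by (intro exI[of _ j]) auto
  qed
qed

section \<open>Networks from curves with matching end points\<close>

text \<open>The relation identifies end points only, so curves whose end points are a function \<open>W\<close> of the vertices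
  descend to the quotient. Continuity need only be checked upstairs, on finitely many closed intervals.\<close>

lemma graph_map_from_edges:
  fixes C :: "nat \<Rightarrow> real \<Rightarrow> 'a::topological_space"
  assumes G: "N_graph N r"
    and cont: "\<And>i. i \<in> {1..N} \<Longrightarrow> continuous_on {0..1} (C i)"
    and vert: "\<And>i z. i \<in> {1..N} \<Longrightarrow> z \<in> {0, 1} \<Longrightarrow> C i z = W (graph_proj r (z, i))"
  obtains \<Gamma> where "continuous_map (subtopology (graph_topology N r) (subgraph r {1..N})) euclidean \<Gamma>"
    and "\<And>i t. i \<in> {1..N} \<Longrightarrow> t \<in> {0..1} \<Longrightarrow> edge_curve r \<Gamma> i t = C i t"
proof -
  define F where "F x = C (snd x) (fst x)" for x :: point
  (* The value does not depend on the representative, since F respects r. *)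
  define \<Gamma> where "\<Gamma> p = F (SOME x. x \<in> p)" for p
  have eq: "equiv (intervals {1..N}) r"
    and r: "\<And>x y. (x, y) \<in> r \<Longrightarrow> x = y \<or> x \<in> endpoints {1..N} \<and> y \<in> endpoints {1..N}"
    using G unfolding N_graph_def by blast+
  have F_vert: "F x = W (graph_proj r x)" if "x \<in> endpoints {1..N}" for x
    using that vert unfolding F_def endpoints_def by (cases x) auto
  have F_resp: "F x = F y" if "(x, y) \<in> r" for x y
    using r[OF that] F_vert[of x] F_vert[of y] equiv_class_eq[OF eq that] unfolding proj_def by auto
  have \<Gamma>F: "\<Gamma> (graph_proj r x) = F x" if "x \<in> intervals {1..N}" for x
  proof -
    have "x \<in> graph_proj r x" unfolding proj_def using equiv_class_self[OF eq that] .
    then have "(SOME y. y \<in> graph_proj r x) \<in> graph_proj r x" by (rule someI)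
    then have "(x, SOME y. y \<in> graph_proj r x) \<in> r" unfolding proj_def by simp
    then show ?thesis unfolding \<Gamma>_def by (metis F_resp)
  qed
  have "continuous_on (\<Union>i\<in>{1..N}. {0..1} \<times> {i}) F"
  proof (rule continuous_on_closed_Union)
    fix i assume i: "i \<in> {1..N}"
    show "closed ({0..1::real} \<times> {i})" by (intro closed_Times) auto
    have "continuous_on ({0..1} \<times> {i}) (\<lambda>x. C i (fst x))"
      by (rule continuous_on_compose2[OF cont[OF i]]) (auto intro: continuous_intros)
    then show "continuous_on ({0..1} \<times> {i}) F"
      by (rule continuous_on_eq) (auto simp: F_def)
  qed simp
  then have "continuous_on (intervals {1..N}) F"
    by (rule continuous_on_subset) (auto simp: intervals_def)
  then have "continuous_on (intervals {1..N}) (\<Gamma> \<circ> graph_proj r)"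
    by (rule continuous_on_eq) (simp add: \<Gamma>F)
  then have "continuous_map (graph_topology N r) euclidean \<Gamma>"
    by (intro continuous_compose_quotient_map[OF quotient_map_graph_topology]) simp
  then show thesis
    by (intro that[of \<Gamma>] continuous_map_from_subtopology)
      (auto simp: edge_curve_def \<Gamma>F intervals_def F_def)
qed

section \<open>The recovery sequence of a degenerate network\<close>

theorem proposition4p2:
  fixes N :: nat and r :: "(point \<times> point) set"
    and D :: "point \<Rightarrow> real^'d" and \<Gamma> :: "point set \<Rightarrow> real^'d"
  assumes "N \<ge> 1" and "CARD('d) \<ge> 2"
    and "N_graph N r" and "assigned_angles N D"
    and "\<Gamma> \<in> C_Deg N r D"
  shows "\<exists>\<Gamma>n :: nat \<Rightarrow> point set \<Rightarrow> real^'d.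
    (\<forall>n. \<Gamma>n n \<in> C_Reg N r D) \<and>
    networks_tendsto_H2 N r \<Gamma>n \<Gamma> \<and>
    (\<lambda>n. ereal (energy N r (\<Gamma>n n))) \<longlonglongrightarrow> extended_energy N r D \<Gamma>"
proof -
  let ?S = "Sing r {1..N} \<Gamma>"
  obtain \<tau> where net: "network N r {1..N} \<Gamma>" and ang: "angle_condition r D {1..N} \<Gamma> \<tau>"
    and strat: "stratified_straight N r D ?S \<tau>"
    using assms(5) unfolding C_Deg_def by blast
  obtain q and \<Sigma> :: "nat \<Rightarrow> point set \<Rightarrow> real^'d" where
    levels: "\<And>i. i \<in> ?S \<Longrightarrow> \<exists>j<q. (\<forall>k<j. edge_curve r (\<Sigma> k) i 1 = edge_curve r (\<Sigma> k) i 0) \<and>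
       edge_curve r (\<Sigma> j) i 1 \<noteq> edge_curve r (\<Sigma> j) i 0 \<and>
       \<tau> (0, i) = sgn (edge_curve r (\<Sigma> j) i 1 - edge_curve r (\<Sigma> j) i 0) \<and>
       \<tau> (1, i) = - sgn (edge_curve r (\<Sigma> j) i 1 - edge_curve r (\<Sigma> j) i 0)"
    by (rule stratified_straight_levels[OF strat]) blast
  define \<epsilon> where "\<epsilon> n = inverse (real (Suc n))" for n
  have \<epsilon>: "0 < \<epsilon> n" "\<epsilon> n \<le> 1" for n by (simp_all add: \<epsilon>_def inverse_le_1_iff)
  have "\<epsilon> \<longlonglongrightarrow> 0"
    unfolding \<epsilon>_def by (rule LIMSEQ_inverse_real_of_nat)
  then have \<epsilon>_lim: "(\<lambda>n. \<epsilon> n ^ 2 ^ k) \<longlonglongrightarrow> 0" for k :: nat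
    by (auto intro!: tendsto_eq_intros)
  (* The perturbed position of p. At a vertex outside the subgraph of level k, the value of the map
     of that level is arbitrary but the same for all n and all edges at p, which is enough. *)
  define W where "W n p = \<Gamma> p + (\<Sum>k<q. \<epsilon> n ^ 2 ^ k *\<^sub>R \<Sigma> k p)" for n p
  have W_lim: "(\<lambda>n. W n p) \<longlonglongrightarrow> \<Gamma> p" for p
  proof -
    have "(\<lambda>n. W n p) \<longlonglongrightarrow> \<Gamma> p + (\<Sum>k<q. 0 *\<^sub>R \<Sigma> k p)"
      unfolding W_def by (intro tendsto_intros \<epsilon>_lim)
    then show ?thesis by simp
  qed
  have "\<exists>C c. (\<forall>t\<in>{0..1}. c t = edge_curve r \<Gamma> i t) \<and>
      recovery_curves (\<lambda>n. W n (graph_proj r (0, i))) (\<lambda>n. W n (graph_proj r (1, i))) (\<tau> (0, i)) (\<tau> (1, i)) C c"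
    if i: "i \<in> {1..N}" for i
  proof (cases "i \<in> ?S")
    case False
    (* A regular edge keeps its shape up to a vanishing cubic. *)
    let ?c = "edge_curve r \<Gamma> i"
    have ns: "\<not> singular_curve ?c" using False i unfolding Sing_def by blast
    then have reg: "regular_curve ?c" using net i unfolding network_def by blast
    have "\<tau> (z, i) = outer_tangent ?c z" if "z \<in> {0, 1}" for z
      using ang i ns that unfolding angle_condition_def tangents_def by metis
    then have "recovery_curves (\<lambda>n. W n (graph_proj r (0, i))) (\<lambda>n. W n (graph_proj r (1, i))) (\<tau> (0, i)) (\<tau> (1, i))
        (\<lambda>n t. ?c t + cubic (W n (graph_proj r (0, i)) - ?c 0) 0
          ((W n (graph_proj r (1, i)) - ?c 1) - (W n (graph_proj r (0, i)) - ?c 0)) t) ?c"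
      using recovery_curves_regular[OF reg, of "\<lambda>n. W n (graph_proj r (0, i))" "\<lambda>n. W n (graph_proj r (1, i))"] W_lim
      by (simp add: edge_curve_def)
    then show ?thesis by blast
  next
    case True
    (* A collapsed edge opens at the scale of the level on which it is a segment. *)
    define x where "x = edge_curve r \<Gamma> i 0"
    define \<Delta> where "\<Delta> k = edge_curve r (\<Sigma> k) i 1 - edge_curve r (\<Sigma> k) i 0" for k
    obtain j where j: "j < q" "\<And>k. k < j \<Longrightarrow> \<Delta> k = 0" "\<Delta> j \<noteq> 0"
        "\<tau> (0, i) = sgn (\<Delta> j)" "\<tau> (1, i) = - sgn (\<Delta> j)"
      using levels[OF True] unfolding \<Delta>_def by auto
    have const: "edge_curve r \<Gamma> i t = x" if "t \<in> {0..1}" for t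
      using True that unfolding Sing_def singular_curve_def constant_on_def x_def by force
    (* The contribution of the limit network itself cancels, as it is constant on the edge. *)
    have "W n (graph_proj r (1, i)) - W n (graph_proj r (0, i)) = (\<Sum>k<q. \<epsilon> n ^ 2 ^ k *\<^sub>R \<Delta> k)" for n
      using const[of 0] const[of 1] unfolding W_def \<Delta>_def edge_curve_def
      by (simp add: sum_subtractf[symmetric] scaleR_diff_right)
    then have rem: "norm (W n (graph_proj r (1, i)) - W n (graph_proj r (0, i)) - \<epsilon> n ^ 2 ^ j *\<^sub>R \<Delta> j)
        \<le> (\<Sum>k<q. norm (\<Delta> k)) * (\<epsilon> n ^ 2 ^ j)\<^sup>2" for n
      using multiscale_remainder[OF \<epsilon> j(1,2)] by simp
    have pos: "0 < \<epsilon> n ^ 2 ^ j" for n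
      using \<epsilon>(1) by (rule zero_less_power)
    have start: "(\<lambda>n. W n (graph_proj r (0, i))) \<longlonglongrightarrow> x"
      using W_lim unfolding x_def edge_curve_def .
    have collapsed: "recovery_curves (\<lambda>n. W n (graph_proj r (0, i))) (\<lambda>n. W n (graph_proj r (1, i))) (sgn (\<Delta> j)) (- sgn (\<Delta> j))
        (\<lambda>n. cubic (W n (graph_proj r (0, i))) (\<epsilon> n ^ 2 ^ j *\<^sub>R \<Delta> j)
          (W n (graph_proj r (1, i)) - W n (graph_proj r (0, i)) - \<epsilon> n ^ 2 ^ j *\<^sub>R \<Delta> j)) (\<lambda>t. x)"
      by (rule recovery_curves_collapsed[OF j(3) pos \<epsilon>_lim start rem])
    show ?thesis
      unfolding j(4,5) by (rule exI, rule exI[of _ "\<lambda>t. x"], rule conjI[OF _ collapsed]) (simp add: const)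
  qed
  then obtain C c where
      c: "\<And>i t. i \<in> {1..N} \<Longrightarrow> t \<in> {0..1} \<Longrightarrow> c i t = edge_curve r \<Gamma> i t" and
      rec: "\<And>i. i \<in> {1..N} \<Longrightarrow> recovery_curves (\<lambda>n. W n (graph_proj r (0, i))) (\<lambda>n. W n (graph_proj r (1, i)))
        (\<tau> (0, i)) (\<tau> (1, i)) (C i) (c i)"
    by metis
  have H2C: "H2 (C i n)" if "i \<in> {1..N}" for i n
    using rec[OF that] unfolding recovery_curves_def H2_tendsto_def by blast
  have "\<exists>\<Gamma>'. continuous_map (subtopology (graph_topology N r) (subgraph r {1..N})) euclidean \<Gamma>' \<and>
      (\<forall>i\<in>{1..N}. \<forall>t\<in>{0..1}. edge_curve r \<Gamma>' i t = C i n t)" for n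
  proof (rule graph_map_from_edges[OF assms(3), of "\<lambda>i. C i n" "W n"])
    show "continuous_on {0..1} (C i n)" if "i \<in> {1..N}" for i
      using H2C[OF that] by (rule H2_continuous_on)
    show "C i n z = W n (graph_proj r (z, i))" if "i \<in> {1..N}" "z \<in> {0, 1}" for i z
      using rec[OF that(1)] that(2) unfolding recovery_curves_def by auto
  qed blast
  then obtain \<Gamma>' where
      cont: "\<And>n. continuous_map (subtopology (graph_topology N r) (subgraph r {1..N})) euclidean (\<Gamma>' n)" and
      edge: "\<And>n i t. i \<in> {1..N} \<Longrightarrow> t \<in> {0..1} \<Longrightarrow> edge_curve r (\<Gamma>' n) i t = C i n t"
    by metis
  have "\<forall>\<^sub>F n in sequentially. \<forall>i\<in>{1..N}. regular_curve (C i n)"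
    using rec unfolding recovery_curves_def by (intro eventually_ball_finite) auto
  then obtain n0 where n0: "\<And>n i. n \<ge> n0 \<Longrightarrow> i \<in> {1..N} \<Longrightarrow> regular_curve (C i n)"
    unfolding eventually_sequentially by blast
  define \<Gamma>n where "\<Gamma>n n = \<Gamma>' (n + n0)" for n
  have edge_n: "C i (n + n0) t = edge_curve r (\<Gamma>n n) i t" if "i \<in> {1..N}" "t \<in> {0..1}" for n i t
    using edge[OF that] unfolding \<Gamma>n_def by simp
  have reg: "regular_curve (edge_curve r (\<Gamma>n n) i)" if "i \<in> {1..N}" for n i
    using regular_curve_cong[OF edge_n[OF that] n0[OF le_add2 that]] .
  have "\<Gamma>n n \<in> C_Reg N r D" for n
  proof -
    have "network N r {1..N} (\<Gamma>n n)"
      unfolding network_def using cont reg unfolding \<Gamma>n_def by blast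
    moreover have "Sing r {1..N} (\<Gamma>n n) = {}"
      unfolding Sing_def using regular_curve_not_singular[OF reg] by blast
    (* The tangents are those of the limit, so its rotations serve for all n. *)
    moreover have "tangents r {1..N} (\<Gamma>n n) \<tau>"
      unfolding tangents_def
    proof
      fix i assume i: "i \<in> {1..N}"
      have "\<tau> (z, i) = outer_tangent (edge_curve r (\<Gamma>n n) i) z" if "z \<in> {0, 1}" for z
      proof -
        have "outer_tangent (C i (n + n0)) z = outer_tangent (edge_curve r (\<Gamma>n n) i) z"
          using edge_n[OF i] that by (rule outer_tangent_cong)
        then show ?thesis using rec[OF i] that unfolding recovery_curves_def by auto
      qed
      then show "if singular_curve (edge_curve r (\<Gamma>n n) i)
          then norm (\<tau> (0, i)) = 1 \<and> \<tau> (0, i) = - \<tau> (1, i)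
          else \<forall>z\<in>{0, 1}. \<tau> (z, i) = outer_tangent (edge_curve r (\<Gamma>n n) i) z"
        using regular_curve_not_singular[OF reg[OF i]] by simp
    qed
    then have "angle_condition r D {1..N} (\<Gamma>n n) \<tau>"
      using ang unfolding angle_condition_def by blast
    ultimately show ?thesis unfolding C_Reg_def by blast
  qed
  moreover have "networks_tendsto_H2 N r \<Gamma>n \<Gamma>"
    unfolding networks_tendsto_H2_def
  proof
    fix i assume i: "i \<in> {1..N}"
    have "H2_tendsto (C i) (c i)" using rec[OF i] unfolding recovery_curves_def by blast
    then have "H2_tendsto (\<lambda>n. C i (n + n0)) (c i)"
      unfolding H2_tendsto_def by (auto dest: LIMSEQ_ignore_initial_segment)
    moreover have "reparametrized (edge_curve r (\<Gamma>n n) i) (C i (n + n0))" for n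
      using edge_n[OF i] by (rule reparametrized_refl)
    moreover have "reparametrized (edge_curve r \<Gamma> i) (c i)"
      using c[OF i] by (rule reparametrized_refl)
    ultimately show "\<exists>d d'. (\<forall>n. reparametrized (edge_curve r (\<Gamma>n n) i) (d n)) \<and>
        reparametrized (edge_curve r \<Gamma> i) d' \<and> H2_tendsto d d'"
      by (intro exI[of _ "\<lambda>n. C i (n + n0)"] exI[of _ "c i"]) blast
  qed
  moreover have "(\<lambda>n. ereal (energy N r (\<Gamma>n n))) \<longlonglongrightarrow> extended_energy N r D \<Gamma>"
  proof -
    have "(\<lambda>n. elastic_energy (edge_curve r (\<Gamma>n n) i)) \<longlonglongrightarrow> elastic_energy (edge_curve r \<Gamma> i)"
      if i: "i \<in> {1..N}" for i
    proof -
      have "(\<lambda>n. elastic_energy (C i n)) \<longlonglongrightarrow> elastic_energy (c i)"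
        using rec[OF i] unfolding recovery_curves_def by blast
      then have "(\<lambda>n. elastic_energy (C i (n + n0))) \<longlonglongrightarrow> elastic_energy (c i)"
        by (rule LIMSEQ_ignore_initial_segment)
      moreover have "elastic_energy (C i (n + n0)) = elastic_energy (edge_curve r (\<Gamma>n n) i)" for n
        using edge_n[OF i] by (rule elastic_energy_cong)
      moreover have "elastic_energy (c i) = elastic_energy (edge_curve r \<Gamma> i)"
        using c[OF i] by (rule elastic_energy_cong)
      ultimately show ?thesis by simp
    qed
    then have "(\<lambda>n. energy N r (\<Gamma>n n)) \<longlonglongrightarrow> energy N r \<Gamma>"
      unfolding energy_eq_sum_elastic_energy by (rule tendsto_sum)
    then show ?thesis
      unfolding extended_energy_def using assms(5) by simp
  qed
  ultimately show ?thesis by blast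
qed

end
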